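(* Let $(P_\theta)_{\theta\in\Theta}$, $\Theta\subseteq\mathbb R^p$, together with a prior $\pi$, satisfy the regularity conditions stated in the context. Let $T$ be an arbitrary randomized $\rho$-zCDP mechanism based on $n$ i.i.d. samples from $P_\theta$, with a standard Borel output space, and let $I_T(\theta)$ denote the Fisher information matrix of its output. Then, for every interior point $\theta$ of $\Theta$, $$ \operatorname{Tr}I_T(\theta)\;\le\;(e^{2\rho}-1)\,n^2\,\|I_x(\theta)\|, $$ where $I_x(\theta)$ is the Fisher information matrix of a single sample and $\|\cdot\|$ is the spectral norm.
   Context: Privacy. Two datasets of $n$ points of the sample space are adjacent if they differ in one observation. For $\lambda>1$ the R\'enyi divergence of laws $P,Q$ is $D_\lambda(P\|Q)=\frac1{\lambda-1}\log\int(\frac{dP}{dQ})^\lambda dQ$ ($=\infty$ if $P\not\ll Q$). A randomized algorithm $A$ is $\rho$-zCDP if $D_\lambda(A(S)\|A(S'))\le\rho\lambda$ for all adjacent $S,S'$ and all $\lambda\in(1,\infty)$ (divergence over the internal randomness of $A$ only). Regularity conditions. $\Theta\subseteq\mathbb R^p$ is compact with piecewise smooth boundary, and $(P_\theta)_{\theta\in\Theta}$ is a dominated model on a standard Borel sample space with densities $p_\theta$. The model is differentiable in quadratic mean at every interior point of $\Theta$, with a jointly measurable score $s(x;\theta)$ satisfying $\mathbb E_\theta s(X;\theta)=0$, $I_x(\theta)=\mathbb E_\theta[s(X;\theta)s(X;\theta)^\top]$, and $\int_\Theta\|I_x(\theta)\|\,d\pi(\theta)<\infty$. The map $\theta\mapsto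 p_\theta$ is continuously differentiable as an $L^1$-valued map on a neighborhood of $\Theta$, with derivative $p_\theta s(\cdot;\theta)$. The prior $\pi$ has a continuously differentiable density, vanishes on the boundary of $\Theta$, and has finite Fisher information matrix $J_\pi=\mathbb E_\pi[\nabla_\theta\log\pi(\theta)\nabla_\theta\log\pi(\theta)^\top]$. Output information. The mechanism is a parameter-independent Markov kernel from $n$-samples to outputs. Differentiability in quadratic mean is inherited by the output experiment, whose score is $s_T(T;\theta)=\mathbb E_\theta[\sum_{i=1}^ns(x_i;\theta)\mid T]$, and $I_T(\theta)=\mathbb E_\theta[s_T(T;\theta)s_T(T;\theta)^\top]$. *)

theory Defs
  imports "HOL-Probability.Probability"
begin

section \<open>Standard Borel spaces\<close>

definition standard_borel :: "'a measure \<Rightarrow> bool" where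
  "standard_borel M \<longleftrightarrow>
    (\<exists>X. completely_metrizable_space X \<and> second_countable X \<and> topspace X = space M \<and>
         sets M = sigma_sets (topspace X) {U. openin X U})"


section \<open>Zero-concentrated differential privacy\<close>

text \<open>
  The library writes \<open>P \<lless> Q\<close> as \<open>absolutely_continuous Q P\<close> and \<open>dP/dQ\<close> as \<open>RN_deriv Q P\<close>.
  For finite measures \<open>RN_deriv Q P\<close> is finite \<open>Q\<close>-almost everywhere, so \<open>enn2real\<close> loses nothing.
\<close>

definition renyi_divergence :: "real \<Rightarrow> 'a measure \<Rightarrow> 'a measure \<Rightarrow> ereal" where
  "renyi_divergence \<alpha> P Q =
    (if absolutely_continuous Q P then
       (let I = (\<integral>\<^sup>+ x. ennreal (enn2real (RN_deriv Q P x) powr \<alpha>) \<partial>Q)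
        in if I = \<infinity> then \<infinity> else ereal (ln (enn2real I) / (\<alpha> - 1)))
     else \<infinity>)"

text \<open>
  A dataset of \<open>n\<close> points is a function on \<open>{..<n}\<close>, i.e. a point of
  \<open>\<Pi>\<^sub>M i\<in>{..<n}. M\<close>; only the \<open>\<sigma>\<close>-algebra of \<open>M\<close> matters here.
\<close>

definition datasets :: "nat \<Rightarrow> 'x measure \<Rightarrow> (nat \<Rightarrow> 'x) measure" where
  "datasets n M = (\<Pi>\<^sub>M i\<in>{..<n}. M)"

definition adjacent :: "nat \<Rightarrow> (nat \<Rightarrow> 'x) \<Rightarrow> (nat \<Rightarrow> 'x) \<Rightarrow> bool" where
  "adjacent n S S' \<longleftrightarrow> (\<exists>i<n. S i \<noteq> S' i \<and> (\<forall>j<n. j \<noteq> i \<longrightarrow> S j = S' j))"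

definition zCDP :: "real \<Rightarrow> nat \<Rightarrow> 'x measure \<Rightarrow> ((nat \<Rightarrow> 'x) \<Rightarrow> 't measure) \<Rightarrow> bool" where
  "zCDP \<rho> n M A \<longleftrightarrow>
    (\<forall>S\<in>space (datasets n M). \<forall>S'\<in>space (datasets n M). adjacent n S S' \<longrightarrow>
       (\<forall>\<alpha>>1. renyi_divergence \<alpha> (A S) (A S') \<le> ereal (\<rho> * \<alpha>)))"


section \<open>Compact sets with piecewise smooth boundary\<close>

text \<open>
  A patch is a compact parametrized hypersurface piece: the image of a compact set \<open>K\<close> in a
  coordinate hyperplane \<open>H\<close> (a copy of \<open>\<real>\<^sup>p\<^sup>-\<^sup>1\<close>), which is the closure of its
  interior \<open>R\<close> relative to \<open>H\<close>, under a map that is \<open>C\<^sup>1\<close> near \<open>K\<close> and an injective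
  immersion on \<open>R\<close>. Degeneration is allowed on \<open>K - R\<close>, so that polar coordinates on
  spheres and cones are admissible. For \<open>p = 1\<close> a patch is a single point.
\<close>

definition smooth_patch :: "(real^'p) set \<Rightarrow> bool" where
  "smooth_patch F \<longleftrightarrow>
    (\<exists>k K W \<phi> D.
       let H = {v :: real^'p. v $ k = 0}; R = (top_of_set H) interior_of K in
         compact K \<and> K \<subseteq> H \<and> K = closure R \<and> open W \<and> K \<subseteq> W \<and>
         (\<forall>x\<in>W. (\<phi> has_derivative D x) (at x)) \<and> (\<forall>v. continuous_on W (\<lambda>x. D x v)) \<and>
         inj_on \<phi> R \<and> (\<forall>x\<in>R. inj_on (D x) H) \<and>
         F = \<phi> ` K)"

definition piecewise_smooth_boundary :: "(real^'p) set \<Rightarrow> bool" where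
  "piecewise_smooth_boundary \<Theta> \<longleftrightarrow>
    (\<exists>\<F>. finite \<F> \<and> (\<forall>F\<in>\<F>. smooth_patch F) \<and> frontier \<Theta> = \<Union>\<F>)"


section \<open>Statistical models\<close>

definition law :: "'x measure \<Rightarrow> (real^'p \<Rightarrow> 'x \<Rightarrow> real) \<Rightarrow> real^'p \<Rightarrow> 'x measure" where
  "law M p \<theta> = density M (\<lambda>x. ennreal (p \<theta> x))"

definition sample_information ::
  "'x measure \<Rightarrow> (real^'p \<Rightarrow> 'x \<Rightarrow> real) \<Rightarrow> ('x \<Rightarrow> real^'p \<Rightarrow> real^'p) \<Rightarrow> real^'p \<Rightarrow> real^'p^'p" where
  "sample_information M p s \<theta> = (\<chi> i j. \<integral>x. s x \<theta> $ i * s x \<theta> $ j \<partial>law M p \<theta>)"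

definition spectral_norm :: "real^'p^'p \<Rightarrow> real" where
  "spectral_norm B = onorm (\<lambda>v. B *v v)"

text \<open>
  The remainder is integrated with values in \<open>[0, \<infinity>]\<close>, so convergence to \<open>0\<close> forces its square
  integrability for small \<open>h\<close>.
\<close>

definition DQM_at ::
  "'x measure \<Rightarrow> (real^'p \<Rightarrow> 'x \<Rightarrow> real) \<Rightarrow> ('x \<Rightarrow> real^'p \<Rightarrow> real^'p) \<Rightarrow> real^'p \<Rightarrow> bool" where
  "DQM_at M p s \<theta> \<longleftrightarrow>
    ((\<lambda>h. (\<integral>\<^sup>+ x. ennreal ((sqrt (p (\<theta> + h) x) - sqrt (p \<theta> x)
                       - (h \<bullet> s x \<theta>) * sqrt (p \<theta> x) / 2)\<^sup>2) \<partial>M) / ennreal ((norm h)\<^sup>2))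
      \<longlongrightarrow> 0) (at 0)"

definition L1_continuously_differentiable_on ::
  "'x measure \<Rightarrow> (real^'p) set \<Rightarrow> (real^'p \<Rightarrow> 'x \<Rightarrow> real) \<Rightarrow> (real^'p \<Rightarrow> 'x \<Rightarrow> real^'p) \<Rightarrow> bool" where
  "L1_continuously_differentiable_on M U f D \<longleftrightarrow>
    (\<forall>\<theta>\<in>U. integrable M (f \<theta>) \<and> integrable M (D \<theta>) \<and>
       ((\<lambda>h. (\<integral>x. \<bar>f (\<theta> + h) x - f \<theta> x - h \<bullet> D \<theta> x\<bar> \<partial>M) / norm h) \<longlongrightarrow> 0) (at 0) \<and>
       ((\<lambda>\<eta>. \<integral>x. norm (D \<eta> x - D \<theta> x) \<partial>M) \<longlongrightarrow> 0) (at \<theta>))"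

definition gradient :: "(real^'p \<Rightarrow> real) \<Rightarrow> real^'p \<Rightarrow> real^'p" where
  "gradient f x = (THE D. GDERIV f x :> D)"

text \<open>
  The prior density \<open>\<pi>\<close> is a function on all of \<open>\<real>\<^sup>p\<close> that is zero off \<open>\<Theta>\<close>. Its score
  \<open>\<nabla> log \<pi>\<close> is meaningful, and is integrated, only on \<open>{\<theta>. 0 < \<pi> \<theta>}\<close>, which has full prior mass.
  Outside \<open>\<Theta>\<close> the functions \<open>p \<theta>\<close> are only required to be integrable, not to be probability
  densities.
\<close>

locale regular_model = sigma_finite_measure M
  for M :: "'x measure" +
  fixes \<Theta> :: "(real^'p) set"
    and p :: "real^'p \<Rightarrow> 'x \<Rightarrow> real"
    and s :: "'x \<Rightarrow> real^'p \<Rightarrow> real^'p"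
    and \<pi> :: "real^'p \<Rightarrow> real"
  assumes standard_borel_sample_space: "standard_borel M"
    and compact_parameters: "compact \<Theta>"
    and piecewise_smooth: "piecewise_smooth_boundary \<Theta>"
    and density_measurable: "\<And>\<theta>. \<theta> \<in> \<Theta> \<Longrightarrow> p \<theta> \<in> borel_measurable M"
    and density_nonneg: "\<And>\<theta> x. \<theta> \<in> \<Theta> \<Longrightarrow> x \<in> space M \<Longrightarrow> 0 \<le> p \<theta> x"
    and law_prob_space: "\<And>\<theta>. \<theta> \<in> \<Theta> \<Longrightarrow> prob_space (law M p \<theta>)"
    and DQM: "\<And>\<theta>. \<theta> \<in> interior \<Theta> \<Longrightarrow> DQM_at M p s \<theta>"
    and score_measurable:
      "case_prod s \<in> borel_measurable (M \<Otimes>\<^sub>M restrict_space borel \<Theta>)"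
    and score_mean_zero:
      "\<And>\<theta>. \<theta> \<in> interior \<Theta> \<Longrightarrow> has_bochner_integral (law M p \<theta>) (\<lambda>x. s x \<theta>) 0"
    and L1_smooth:
      "\<exists>U. open U \<and> \<Theta> \<subseteq> U \<and>
           L1_continuously_differentiable_on M U p (\<lambda>\<theta> x. p \<theta> x *\<^sub>R s x \<theta>)"
    and prior_nonneg: "\<And>\<theta>. 0 \<le> \<pi> \<theta>"
    and prior_support: "\<And>\<theta>. \<theta> \<notin> \<Theta> \<Longrightarrow> \<pi> \<theta> = 0"
    and prior_prob_space: "prob_space (density lborel (\<lambda>\<theta>. ennreal (\<pi> \<theta>)))"
    and prior_continuous: "continuous_on \<Theta> \<pi>"
    and prior_differentiable: "\<And>\<theta>. \<theta> \<in> interior \<Theta> \<Longrightarrow> GDERIV \<pi> \<theta> :> gradient \<pi> \<theta>"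
    and prior_gradient_continuous: "continuous_on (interior \<Theta>) (gradient \<pi>)"
    and prior_boundary: "\<And>\<theta>. \<theta> \<in> frontier \<Theta> \<Longrightarrow> \<pi> \<theta> = 0"
    and prior_information_finite:
      "\<And>i j. set_integrable (density lborel (\<lambda>\<theta>. ennreal (\<pi> \<theta>))) {\<theta>. 0 < \<pi> \<theta>}
         (\<lambda>\<theta>. gradient (\<lambda>\<eta>. ln (\<pi> \<eta>)) \<theta> $ i * gradient (\<lambda>\<eta>. ln (\<pi> \<eta>)) \<theta> $ j)"
    and sample_information_finite:
      "(\<integral>\<^sup>+ \<theta>. ennreal (spectral_norm (sample_information M p s \<theta>))
          \<partial>density lborel (\<lambda>\<theta>. ennreal (\<pi> \<theta>))) < \<infinity>"


section \<open>Information carried by the output of a mechanism\<close>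

text \<open>The joint law of the i.i.d. sample and the output \<open>T\<close>, the latter being the second coordinate.\<close>

definition joint_law ::
  "'x measure \<Rightarrow> (real^'p \<Rightarrow> 'x \<Rightarrow> real) \<Rightarrow> nat \<Rightarrow> ((nat \<Rightarrow> 'x) \<Rightarrow> 't measure) \<Rightarrow> 't measure \<Rightarrow>
   real^'p \<Rightarrow> ((nat \<Rightarrow> 'x) \<times> 't) measure" where
  "joint_law M p n A N \<theta> =
    do {
      S \<leftarrow> (\<Pi>\<^sub>M i\<in>{..<n}. law M p \<theta>);
      t \<leftarrow> A S;
      return (datasets n M \<Otimes>\<^sub>M N) (S, t)
    }"

text \<open>The conditional expectation given \<open>T\<close> is taken componentwise, on the joint space, given \<open>\<sigma>(T)\<close>.\<close>

definition output_score ::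
  "'x measure \<Rightarrow> (real^'p \<Rightarrow> 'x \<Rightarrow> real) \<Rightarrow> ('x \<Rightarrow> real^'p \<Rightarrow> real^'p) \<Rightarrow> nat \<Rightarrow>
   ((nat \<Rightarrow> 'x) \<Rightarrow> 't measure) \<Rightarrow> 't measure \<Rightarrow> real^'p \<Rightarrow> (nat \<Rightarrow> 'x) \<times> 't \<Rightarrow> real^'p" where
  "output_score M p s n A N \<theta> \<omega> =
    (\<chi> i. real_cond_exp (joint_law M p n A N \<theta>)
            (vimage_algebra (space (joint_law M p n A N \<theta>)) snd N)
            (\<lambda>(S, t). (\<Sum>k<n. s (S k) \<theta>) $ i) \<omega>)"

definition output_information ::
  "'x measure \<Rightarrow> (real^'p \<Rightarrow> 'x \<Rightarrow> real) \<Rightarrow> ('x \<Rightarrow> real^'p \<Rightarrow> real^'p) \<Rightarrow> nat \<Rightarrow>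
   ((nat \<Rightarrow> 'x) \<Rightarrow> 't measure) \<Rightarrow> 't measure \<Rightarrow> real^'p \<Rightarrow> real^'p^'p" where
  "output_information M p s n A N \<theta> =
    (\<chi> i j. \<integral>\<omega>. output_score M p s n A N \<theta> \<omega> $ i * output_score M p s n A N \<theta> \<omega> $ j
               \<partial>joint_law M p n A N \<theta>)"

end

theory Submission
  imports Defs
begin

text \<open>
  Write \<open>g(T)\<close> for the conditional expectation of \<open>\<Sum>k. s(S k)\<close> given the output \<open>T\<close>, and
  \<open>\<tau> = E |g(T)|\<^sup>2\<close> for the trace of the output information. Conditional expectation is an orthogonal
  projection, so \<open>\<tau> = \<Sum>k. E[g(T) \<bullet> s(S k)]\<close>, and it is enough to bound the correlation of the
  output with one observation.

  For this, resample: let \<open>x\<close> be a fresh observation independent of the dataset \<open>S\<close>, let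
  \<open>S(k := x)\<close> be the dataset with \<open>x\<close> put in place \<open>k\<close>, which has the law of \<open>S\<close>.
  With \<open>A S\<close> the law of the output on the dataset \<open>S\<close>, \<open>E[g(T) \<bullet> s(S k)]\<close> is the average over \<open>S\<close>
  and \<open>x\<close> of the expectation of \<open>g(T) \<bullet> s(x)\<close> under \<open>A (S(k := x))\<close>. The same average with the
  expectation under \<open>A S\<close> is zero, as the output then ignores \<open>x\<close> and the score has mean zero. So the
  correlation is an average of differences of the expectations of one function \<open>f = g \<bullet> s(x)\<close> under
  the output laws of two datasets that differ in at most one place.

  The Renyi divergence of order 2 controls such a difference: if \<open>r\<close> is the density of the first law
  with respect to the second, then \<open>\<integral>(r - 1)\<^sup>2 \<le> exp (2 \<rho>) - 1\<close>, and for every \<open>l > 0\<close>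
  \<open>\<integral>f (r - 1) \<le> (\<integral>f\<^sup>2) / (2 l) + (l / 2) (exp (2 \<rho>) - 1)\<close>.
  In the first term on the right \<open>x\<close> is again independent of the output, so that averaging \<open>f\<^sup>2\<close> over
  \<open>x\<close> gives the quadratic form of the sample information at \<open>g(T)\<close>, which is at most
  \<open>B |g(T)|\<^sup>2\<close> with \<open>B\<close> its spectral norm. Summing over \<open>k\<close>,
  \<open>\<tau> \<le> n (B \<tau> / (2 l) + (l / 2) (exp (2 \<rho>) - 1))\<close>,
  and for \<open>n B > 0\<close> the choice \<open>l = n B\<close> turns this into
  \<open>\<tau> \<le> (exp (2 \<rho>) - 1) n\<^sup>2 B\<close>. The additive form of the
  Cauchy-Schwarz inequality, with a free constant \<open>l\<close>, makes it possible to integrate over \<open>S\<close> and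
  \<open>x\<close> term by term.

  The estimate of one correlation is \<open>correlation_bound\<close>, and the summation is
  \<open>conditional_score_information\<close>. Differentiability in quadratic mean enters through
  \<open>integrable_score_square\<close>, which makes the Fisher information of a sample a genuine integral. For
  \<open>\<rho> < 0\<close> no two datasets can be adjacent; then, unless \<open>n = 0\<close>, the sample space is a single point
  and both informations vanish.
\<close>


section \<open>The joint law of an input and the output of a kernel\<close>

definition kernel_joint :: "'a measure \<Rightarrow> ('a \<Rightarrow> 'b measure) \<Rightarrow> 'b measure \<Rightarrow> ('a \<times> 'b) measure" where
  "kernel_joint Q K N = Q \<bind> (\<lambda>x. K x \<bind> (\<lambda>y. return (Q \<Otimes>\<^sub>M N) (x, y)))"

lemma
  assumes K[measurable]: "K \<in> Q \<rightarrow>\<^sub>M prob_algebra N" and Q: "prob_space Q"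
  shows sets_kernel_joint: "sets (kernel_joint Q K N) = sets (Q \<Otimes>\<^sub>M N)"
    and prob_space_kernel_joint: "prob_space (kernel_joint Q K N)"
    and nn_integral_kernel_joint:
      "\<And>f. f \<in> borel_measurable (Q \<Otimes>\<^sub>M N) \<Longrightarrow>
        (\<integral>\<^sup>+\<omega>. f \<omega> \<partial>kernel_joint Q K N) = (\<integral>\<^sup>+x. \<integral>\<^sup>+y. f (x, y) \<partial>K x \<partial>Q)"
proof -
  interpret Q: prob_space Q by fact
  have ret: "(\<lambda>y. return (Q \<Otimes>\<^sub>M N) (x, y)) \<in> N \<rightarrow>\<^sub>M prob_algebra (Q \<Otimes>\<^sub>M N)"
    if [simp]: "x \<in> space Q" for x
    by measurable
  have inner: "(\<lambda>x. K x \<bind> (\<lambda>y. return (Q \<Otimes>\<^sub>M N) (x, y))) \<in> Q \<rightarrow>\<^sub>M prob_algebra (Q \<Otimes>\<^sub>M N)"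
    by measurable
  have sub: "(\<lambda>x. K x \<bind> (\<lambda>y. return (Q \<Otimes>\<^sub>M N) (x, y))) \<in> Q \<rightarrow>\<^sub>M subprob_algebra (Q \<Otimes>\<^sub>M N)"
    by (rule measurable_prob_algebraD[OF inner])
  have QP: "Q \<in> space (prob_algebra Q)"
    using Q by (simp add: space_prob_algebra)
  have J: "kernel_joint Q K N \<in> space (prob_algebra (Q \<Otimes>\<^sub>M N))"
    unfolding kernel_joint_def
    by (intro measurable_space[OF measurable_bind_prob_space[OF _ inner] QP]) measurable
  then show "sets (kernel_joint Q K N) = sets (Q \<Otimes>\<^sub>M N)" "prob_space (kernel_joint Q K N)"
    by (auto simp: space_prob_algebra)
  fix f :: "_ \<Rightarrow> ennreal" assume f[measurable]: "f \<in> borel_measurable (Q \<Otimes>\<^sub>M N)"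
  have "(\<integral>\<^sup>+\<omega>. f \<omega> \<partial>kernel_joint Q K N) =
        (\<integral>\<^sup>+x. \<integral>\<^sup>+\<omega>. f \<omega> \<partial>(K x \<bind> (\<lambda>y. return (Q \<Otimes>\<^sub>M N) (x, y))) \<partial>Q)"
    unfolding kernel_joint_def by (rule nn_integral_bind[OF f sub])
  also have "\<dots> = (\<integral>\<^sup>+x. \<integral>\<^sup>+y. f (x, y) \<partial>K x \<partial>Q)"
  proof (rule nn_integral_cong)
    fix x assume x: "x \<in> space Q"
    have Kx: "sets (K x) = sets N" and spKx: "space (K x) = space N"
      using measurable_space[OF K x] by (auto simp: space_prob_algebra dest: sets_eq_imp_space_eq)
    have m: "(\<lambda>y. return (Q \<Otimes>\<^sub>M N) (x, y)) \<in> K x \<rightarrow>\<^sub>M subprob_algebra (Q \<Otimes>\<^sub>M N)"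
      using measurable_prob_algebraD[OF ret[OF x]] by (simp add: measurable_cong_sets[OF Kx refl])
    show "(\<integral>\<^sup>+\<omega>. f \<omega> \<partial>(K x \<bind> (\<lambda>y. return (Q \<Otimes>\<^sub>M N) (x, y)))) = (\<integral>\<^sup>+y. f (x, y) \<partial>K x)"
      unfolding nn_integral_bind[OF f m]
      by (intro nn_integral_cong nn_integral_return f) (auto simp: x space_pair_measure spKx)
  qed
  finally show "(\<integral>\<^sup>+\<omega>. f \<omega> \<partial>kernel_joint Q K N) = (\<integral>\<^sup>+x. \<integral>\<^sup>+y. f (x, y) \<partial>K x \<partial>Q)" .
qed

lemma kernel_space:
  assumes "K \<in> Q \<rightarrow>\<^sub>M prob_algebra N" "x \<in> space Q"
  shows "prob_space (K x)" "sets (K x) = sets N" "space (K x) = space N"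
  using measurable_space[OF assms] by (auto simp: space_prob_algebra dest: sets_eq_imp_space_eq)

text \<open>
  An integrand that depends on the input becomes a fixed one once the output law is replaced by its image
  on the product space, and for a fixed integrand the integral is a measurable function of the measure.
\<close>

lemma integral_measurable_kernel:
  fixes f :: "'a \<times> 'b \<Rightarrow> 'c::{banach, second_countable_topology}"
  assumes K: "K \<in> Q \<rightarrow>\<^sub>M prob_algebra N" and f[measurable]: "f \<in> borel_measurable (Q \<Otimes>\<^sub>M N)"
  shows "(\<lambda>x. \<integral>y. f (x, y) \<partial>K x) \<in> borel_measurable Q"
proof -
  note [measurable] = measurable_prob_algebraD[OF K] measurable_distr2
  have "(\<lambda>x. integral\<^sup>L (distr (K x) (Q \<Otimes>\<^sub>M N) (\<lambda>y. (x, y))) f) \<in> borel_measurable Q"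
    by measurable
  moreover have "integral\<^sup>L (distr (K x) (Q \<Otimes>\<^sub>M N) (\<lambda>y. (x, y))) f = (\<integral>y. f (x, y) \<partial>K x)"
    if "x \<in> space Q" for x
    using that by (intro integral_distr f) (simp add: measurable_cong_sets[OF kernel_space(2)[OF K that] refl])
  ultimately show ?thesis
    by (subst measurable_cong[where g="\<lambda>x. integral\<^sup>L (distr (K x) (Q \<Otimes>\<^sub>M N) (\<lambda>y. (x, y))) f"]) simp_all
qed

text \<open>
  Fubini's theorem for signed integrands, from the nonnegative case: the positive and the negative part
  are treated separately, and the inner integrals may fail to exist on a null set of inputs.
\<close>

lemma
  fixes f :: "'a \<times> 'b \<Rightarrow> real"
  assumes K[measurable]: "K \<in> Q \<rightarrow>\<^sub>M prob_algebra N" and Q: "prob_space Q"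
    and f: "integrable (kernel_joint Q K N) f"
  shows AE_integrable_kernel_joint: "AE x in Q. integrable (K x) (\<lambda>y. f (x, y))"
    and integrable_kernel_joint: "integrable Q (\<lambda>x. \<integral>y. f (x, y) \<partial>K x)"
    and integral_kernel_joint: "(\<integral>\<omega>. f \<omega> \<partial>kernel_joint Q K N) = (\<integral>x. \<integral>y. f (x, y) \<partial>K x \<partial>Q)"
proof -
  note [measurable] = measurable_prob_algebraD[OF K]
  have all: "(AE x in Q. integrable (K x) (\<lambda>y. f (x, y))) \<and>
      integrable Q (\<lambda>x. \<integral>y. f (x, y) \<partial>K x) \<and>
      (\<integral>\<omega>. f \<omega> \<partial>kernel_joint Q K N) = (\<integral>x. \<integral>y. f (x, y) \<partial>K x \<partial>Q)"
    if f: "integrable (kernel_joint Q K N) f" and pos: "\<And>\<omega>. 0 \<le> f \<omega>" for f :: "'a \<times> 'b \<Rightarrow> real"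
  proof -
    have fm[measurable]: "f \<in> borel_measurable (Q \<Otimes>\<^sub>M N)"
      using borel_measurable_integrable[OF f]
      by (simp add: measurable_cong_sets[OF sets_kernel_joint[OF K Q] refl])
    have fx: "(\<lambda>y. f (x, y)) \<in> borel_measurable (K x)" if "x \<in> space Q" for x
      using measurable_compose[OF measurable_Pair1'[OF that] fm]
      by (simp add: measurable_cong_sets[OF kernel_space(2)[OF K that] refl])
    have nn: "(\<integral>\<^sup>+\<omega>. ennreal (f \<omega>) \<partial>kernel_joint Q K N) = (\<integral>\<^sup>+x. \<integral>\<^sup>+y. ennreal (f (x, y)) \<partial>K x \<partial>Q)"
      by (rule nn_integral_kernel_joint[OF K Q]) measurable
    have mi: "(\<lambda>x. \<integral>\<^sup>+y. ennreal (f (x, y)) \<partial>K x) \<in> borel_measurable Q"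
      by (rule nn_integral_measurable_subprob_algebra2[where N=N]) measurable
    have fin: "(\<integral>\<^sup>+\<omega>. ennreal (f \<omega>) \<partial>kernel_joint Q K N) = ennreal (\<integral>\<omega>. f \<omega> \<partial>kernel_joint Q K N)"
      by (rule nn_integral_eq_integral[OF f]) (simp add: pos)
    have "AE x in Q. (\<integral>\<^sup>+y. ennreal (f (x, y)) \<partial>K x) \<noteq> \<infinity>"
      using mi by (rule nn_integral_PInf_AE) (use fin nn in simp)
    then have AEi: "AE x in Q. integrable (K x) (\<lambda>y. f (x, y))"
      by (rule AE_mp) (auto intro!: AE_I2 integrableI_nonneg fx simp: pos less_top)
    have eqx: "AE x in Q. (\<integral>\<^sup>+y. ennreal (f (x, y)) \<partial>K x) = ennreal (\<integral>y. f (x, y) \<partial>K x)"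
      using AEi by eventually_elim (simp add: nn_integral_eq_integral pos)
    have eq: "(\<integral>\<^sup>+x. ennreal (\<integral>y. f (x, y) \<partial>K x) \<partial>Q) = ennreal (\<integral>\<omega>. f \<omega> \<partial>kernel_joint Q K N)"
      using nn fin nn_integral_cong_AE[OF eqx] by simp
    have mL: "(\<lambda>x. \<integral>y. f (x, y) \<partial>K x) \<in> borel_measurable Q"
    proof -
      have "(\<lambda>x. enn2real (\<integral>\<^sup>+y. ennreal (f (x, y)) \<partial>K x)) \<in> borel_measurable Q"
        using mi by measurable
      then show ?thesis
        by (rule measurable_cong[THEN iffD1, rotated]) (simp add: integral_eq_nn_integral fx pos)
    qed
    have int: "integrable Q (\<lambda>x. \<integral>y. f (x, y) \<partial>K x)"
      by (rule integrableI_nonneg[OF mL]) (use eq in \<open>auto simp: pos\<close>)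
    have "ennreal (\<integral>x. \<integral>y. f (x, y) \<partial>K x \<partial>Q) = ennreal (\<integral>\<omega>. f \<omega> \<partial>kernel_joint Q K N)"
      using eq by (simp add: nn_integral_eq_integral[OF int] pos)
    then have "(\<integral>x. \<integral>y. f (x, y) \<partial>K x \<partial>Q) = (\<integral>\<omega>. f \<omega> \<partial>kernel_joint Q K N)"
      by (simp add: pos)
    with AEi int show ?thesis by simp
  qed
  define u where "u \<omega> = max 0 (f \<omega>)" for \<omega>
  define v where "v \<omega> = max 0 (- f \<omega>)" for \<omega>
  have uv: "f \<omega> = u \<omega> - v \<omega>" for \<omega> by (simp add: u_def v_def)
  have iu: "integrable (kernel_joint Q K N) u" and iv: "integrable (kernel_joint Q K N) v"
    unfolding u_def v_def using f by auto
  note U = all[OF iu] and V = all[OF iv]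
  have Ua: "AE x in Q. integrable (K x) (\<lambda>y. u (x, y))" "integrable Q (\<lambda>x. \<integral>y. u (x, y) \<partial>K x)"
      "(\<integral>\<omega>. u \<omega> \<partial>kernel_joint Q K N) = (\<integral>x. \<integral>y. u (x, y) \<partial>K x \<partial>Q)"
    using U by (auto simp: u_def)
  have Va: "AE x in Q. integrable (K x) (\<lambda>y. v (x, y))" "integrable Q (\<lambda>x. \<integral>y. v (x, y) \<partial>K x)"
      "(\<integral>\<omega>. v \<omega> \<partial>kernel_joint Q K N) = (\<integral>x. \<integral>y. v (x, y) \<partial>K x \<partial>Q)"
    using V by (auto simp: v_def)
  show A: "AE x in Q. integrable (K x) (\<lambda>y. f (x, y))"
    using Ua(1) Va(1) by eventually_elim (simp add: uv)
  have E: "AE x in Q. (\<integral>y. u (x, y) \<partial>K x) - (\<integral>y. v (x, y) \<partial>K x) = (\<integral>y. f (x, y) \<partial>K x)"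
    using Ua(1) Va(1) by eventually_elim (simp add: uv)
  have fm[measurable]: "f \<in> borel_measurable (Q \<Otimes>\<^sub>M N)"
    using borel_measurable_integrable[OF f]
    by (simp add: measurable_cong_sets[OF sets_kernel_joint[OF K Q] refl])
  have mL: "(\<lambda>x. \<integral>y. f (x, y) \<partial>K x) \<in> borel_measurable Q"
    by (rule integral_measurable_kernel[OF K fm])
  have D: "integrable Q (\<lambda>x. (\<integral>y. u (x, y) \<partial>K x) - (\<integral>y. v (x, y) \<partial>K x))"
    using Ua(2) Va(2) by simp
  show "integrable Q (\<lambda>x. \<integral>y. f (x, y) \<partial>K x)"
    by (rule integrable_cong_AE_imp[OF D mL E])
  have "(\<integral>\<omega>. f \<omega> \<partial>kernel_joint Q K N)
      = (\<integral>\<omega>. u \<omega> \<partial>kernel_joint Q K N) - (\<integral>\<omega>. v \<omega> \<partial>kernel_joint Q K N)"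
    using iu iv by (simp add: uv)
  also have "\<dots> = (\<integral>x. (\<integral>y. u (x, y) \<partial>K x) - (\<integral>y. v (x, y) \<partial>K x) \<partial>Q)"
    using Ua Va by simp
  also have "\<dots> = (\<integral>x. \<integral>y. f (x, y) \<partial>K x \<partial>Q)"
    using E mL D by (intro integral_cong_AE) auto
  finally show "(\<integral>\<omega>. f \<omega> \<partial>kernel_joint Q K N) = (\<integral>x. \<integral>y. f (x, y) \<partial>K x \<partial>Q)" .
qed

lemma distr_fst_kernel_joint:
  assumes K: "K \<in> Q \<rightarrow>\<^sub>M prob_algebra N" and Q: "prob_space Q"
  shows "distr (kernel_joint Q K N) Q fst = Q"
proof (rule measure_eqI)
  fix X assume "X \<in> sets (distr (kernel_joint Q K N) Q fst)"
  then have X[measurable]: "X \<in> sets Q" by simp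
  note [measurable_cong] = sets_kernel_joint[OF K Q]
  have "emeasure (distr (kernel_joint Q K N) Q fst) X
      = (\<integral>\<^sup>+\<omega>. indicator X (fst \<omega>) \<partial>kernel_joint Q K N)"
    by (subst nn_integral_distr[symmetric, where M'=Q]) simp_all
  also have "\<dots> = (\<integral>\<^sup>+x. \<integral>\<^sup>+y. indicator X x \<partial>K x \<partial>Q)"
    by (subst nn_integral_kernel_joint[OF K Q]) simp_all
  also have "\<dots> = (\<integral>\<^sup>+x. indicator X x \<partial>Q)"
    by (intro nn_integral_cong)
       (simp add: prob_space.emeasure_space_1[OF kernel_space(1)[OF K]])
  finally show "emeasure (distr (kernel_joint Q K N) Q fst) X = emeasure Q X" by simp
qed simp


section \<open>Renyi divergence of order two\<close>

text \<open>
  Order two is the chi-square divergence: as \<open>\<integral>r = 1\<close>, the integral \<open>\<integral>r\<^sup>2\<close> that the divergence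
  takes the logarithm of equals \<open>1 + \<integral>(r - 1)\<^sup>2\<close>.
\<close>

lemma renyi_two_bound:
  fixes P Q :: "'a measure"
  assumes P: "prob_space P" and Q: "prob_space Q" and sets: "sets P = sets Q"
    and D: "renyi_divergence 2 P Q \<le> ereal (2 * \<rho>)"
  obtains r where "r \<in> borel_measurable Q" "\<And>x. 0 \<le> r x" "P = density Q (\<lambda>x. ennreal (r x))"
    "integrable Q (\<lambda>x. (r x - 1)\<^sup>2)" "(\<integral>x. (r x - 1)\<^sup>2 \<partial>Q) \<le> exp (2 * \<rho>) - 1"
proof -
  interpret P: prob_space P by fact
  interpret Q: prob_space Q by fact
  define r where "r x = enn2real (RN_deriv Q P x)" for x
  have r[measurable]: "r \<in> borel_measurable Q" unfolding r_def by measurable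
  have r0: "0 \<le> r x" for x by (simp add: r_def)
  have ac: "absolutely_continuous Q P"
    using D by (auto simp: renyi_divergence_def split: if_splits)
  have "AE x in Q. RN_deriv Q P x = ennreal (r x)"
    using Q.RN_deriv_finite[OF P.sigma_finite_measure_axioms ac sets]
    by eventually_elim (simp add: r_def less_top)
  then have "density Q (RN_deriv Q P) = density Q (\<lambda>x. ennreal (r x))"
    by (intro density_cong) auto
  then have dens: "P = density Q (\<lambda>x. ennreal (r x))"
    using Q.density_RN_deriv[OF ac sets] by simp
  have ri: "integrable Q r" and r1: "(\<integral>x. r x \<partial>Q) = 1"
  proof -
    have "emeasure P (space P) = (\<integral>\<^sup>+x. ennreal (r x) \<partial>Q)"
      by (subst (1) dens) (simp add: emeasure_density nn_integral_set_ennreal sets_eq_imp_space_eq[OF sets] cong: nn_integral_cong)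
    then have e: "(\<integral>\<^sup>+x. ennreal (r x) \<partial>Q) = 1" by (simp add: P.emeasure_space_1)
    show "integrable Q r" by (rule integrableI_nonneg) (auto simp: r0 e)
    show "(\<integral>x. r x \<partial>Q) = 1" by (simp add: integral_eq_nn_integral r0 e)
  qed
  define I where "I = (\<integral>\<^sup>+x. ennreal (r x powr 2) \<partial>Q)"
  have pw: "r x powr 2 = (r x)\<^sup>2" for x using r0[of x] by (simp add: powr_numeral)
  have bnd: "I \<noteq> \<infinity>" "ln (enn2real I) \<le> 2 * \<rho>"
    using D ac by (auto simp: renyi_divergence_def r_def[symmetric] I_def[symmetric] Let_def split: if_splits)
  have r2: "integrable Q (\<lambda>x. (r x)\<^sup>2)"
    using bnd(1) by (intro integrableI_nonneg) (auto simp: I_def pw less_top)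
  have I2: "enn2real I = (\<integral>x. (r x)\<^sup>2 \<partial>Q)"
    by (simp add: integral_eq_nn_integral I_def pw)
  have exp2: "(r x - 1)\<^sup>2 = (r x)\<^sup>2 - 2 * r x + 1" for x by (simp add: power2_eq_square algebra_simps)
  have i2: "integrable Q (\<lambda>x. (r x - 1)\<^sup>2)" unfolding exp2 using r2 ri by simp
  have val: "(\<integral>x. (r x - 1)\<^sup>2 \<partial>Q) = enn2real I - 1"
    unfolding exp2 I2 using r2 ri by (simp add: r1 Q.prob_space)
  have "0 \<le> (\<integral>x. (r x - 1)\<^sup>2 \<partial>Q)" by simp
  then have "enn2real I > 0" using val by simp
  then have "enn2real I \<le> exp (2 * \<rho>)" using bnd(2) by (metis exp_le_cancel_iff exp_ln)
  then show ?thesis using that[OF r r0 dens i2] val by simp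
qed

text \<open>
  The additive form of Cauchy-Schwarz: both integrals are over \<open>Q\<close> after a change of measure, and
  \<open>(f - l (r - 1))\<^sup>2 \<ge> 0\<close> bounds the integrand \<open>f (r - 1)\<close>.
\<close>

lemma integral_diff_le_chi_square:
  fixes f :: "'a \<Rightarrow> real"
  assumes P: "prob_space P" and Q: "prob_space Q" and sets: "sets P = sets Q"
    and D: "renyi_divergence 2 P Q \<le> ereal (2 * \<rho>)"
    and fP: "integrable P f" and fQ: "integrable Q f" and f2: "integrable Q (\<lambda>x. (f x)\<^sup>2)" and l: "0 < l"
  shows "(\<integral>x. f x \<partial>P) - (\<integral>x. f x \<partial>Q) \<le> (\<integral>x. (f x)\<^sup>2 \<partial>Q) / (2 * l) + l / 2 * (exp (2 * \<rho>) - 1)"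
proof -
  obtain r where r[measurable]: "r \<in> borel_measurable Q" and r0: "\<And>x. 0 \<le> r x"
    and dens: "P = density Q (\<lambda>x. ennreal (r x))"
    and i2: "integrable Q (\<lambda>x. (r x - 1)\<^sup>2)" and c: "(\<integral>x. (r x - 1)\<^sup>2 \<partial>Q) \<le> exp (2 * \<rho>) - 1"
    using renyi_two_bound[OF P Q sets D] by blast
  have fm[measurable]: "f \<in> borel_measurable Q" using fQ by simp
  have rf: "integrable Q (\<lambda>x. r x * f x)"
    using fP by (subst (asm) dens) (simp add: integrable_density r0)
  have "(\<integral>x. f x \<partial>P) - (\<integral>x. f x \<partial>Q) = (\<integral>x. r x * f x - f x \<partial>Q)"
    using rf fQ by (subst dens) (simp add: integral_density r0)
  also have "\<dots> \<le> (\<integral>x. (f x)\<^sup>2 / (2 * l) + l / 2 * (r x - 1)\<^sup>2 \<partial>Q)"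
  proof (rule integral_mono)
    fix x
    have "0 \<le> (f x - l * (r x - 1))\<^sup>2 / (2 * l)" using l by simp
    also have "\<dots> = (f x)\<^sup>2 / (2 * l) + l / 2 * (r x - 1)\<^sup>2 - (r x * f x - f x)"
      using l by (simp add: power2_eq_square field_simps)
    finally show "r x * f x - f x \<le> (f x)\<^sup>2 / (2 * l) + l / 2 * (r x - 1)\<^sup>2" by simp
  qed (use rf fQ f2 i2 in auto)
  also have "\<dots> = (\<integral>x. (f x)\<^sup>2 \<partial>Q) / (2 * l) + l / 2 * (\<integral>x. (r x - 1)\<^sup>2 \<partial>Q)"
    using f2 i2 by simp
  also have "\<dots> \<le> (\<integral>x. (f x)\<^sup>2 \<partial>Q) / (2 * l) + l / 2 * (exp (2 * \<rho>) - 1)"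
    using c l by (intro add_mono mult_left_mono) auto
  finally show ?thesis .
qed


section \<open>Square integrability and conditional expectation\<close>

lemma (in finite_measure) integrable_norm_of_square:
  fixes f :: "'a \<Rightarrow> 'b::{banach, second_countable_topology}"
  assumes f: "f \<in> borel_measurable M" and f2: "integrable M (\<lambda>x. (norm (f x))\<^sup>2)"
  shows "integrable M f"
proof (rule Bochner_Integration.integrable_bound[OF _ f])
  show "integrable M (\<lambda>x. 1 + (norm (f x))\<^sup>2)" using f2 by simp
  have "u \<le> 1 + u\<^sup>2" for u :: real
    using zero_le_power2[of "u - 1 / 2"] by (simp add: power2_eq_square field_simps)
  then show "AE x in M. norm (f x) \<le> norm (1 + (norm (f x))\<^sup>2)"
    by (intro AE_I2) (simp add: abs_of_nonneg)
qed

lemma integrable_inner_of_squares: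
  fixes f g :: "'a \<Rightarrow> 'b::euclidean_space"
  assumes [measurable]: "f \<in> borel_measurable M" "g \<in> borel_measurable M"
    and f2: "integrable M (\<lambda>x. (norm (f x))\<^sup>2)" and g2: "integrable M (\<lambda>x. (norm (g x))\<^sup>2)"
  shows "integrable M (\<lambda>x. f x \<bullet> g x)"
proof (rule Bochner_Integration.integrable_bound)
  show "integrable M (\<lambda>x. (norm (f x))\<^sup>2 + (norm (g x))\<^sup>2)" using f2 g2 by simp
  have "\<bar>f x \<bullet> g x\<bar> \<le> (norm (f x))\<^sup>2 + (norm (g x))\<^sup>2" for x
  proof -
    have "\<bar>f x \<bullet> g x\<bar> \<le> norm (f x) * norm (g x)" by (rule Cauchy_Schwarz_ineq2)
    also have "\<dots> \<le> (norm (f x))\<^sup>2 + (norm (g x))\<^sup>2"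
      using sum_squares_bound[of "norm (f x)" "norm (g x)"] mult_nonneg_nonneg[OF norm_ge_zero norm_ge_zero, of "f x" "g x"]
      by linarith
    finally show ?thesis .
  qed
  then show "AE x in M. norm (f x \<bullet> g x) \<le> norm ((norm (f x))\<^sup>2 + (norm (g x))\<^sup>2)"
    by (intro AE_I2) (auto intro: order_trans)
qed measurable

text \<open>
  A function of \<open>(x, t)\<close> that is measurable with respect to \<open>t\<close> is a function of \<open>t\<close>, and any slice
  \<open>x = x0\<close> provides it: the level set through \<open>(x0, t)\<close> is a cylinder over a set of \<open>t\<close>'s, hence
  contains every \<open>(x, t)\<close>.
\<close>

lemma vimage_snd_factorization:
  fixes f :: "'a \<times> 'b \<Rightarrow> 'c::{t1_space}"
  assumes f: "f \<in> borel_measurable (vimage_algebra (X \<times> space N) snd N)" and x0: "x0 \<in> X"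
  shows "(\<lambda>t. f (x0, t)) \<in> borel_measurable N"
    and "\<And>x t. x \<in> X \<Longrightarrow> t \<in> space N \<Longrightarrow> f (x, t) = f (x0, t)"
proof -
  have "(\<lambda>t. (x0, t)) \<in> N \<rightarrow>\<^sub>M vimage_algebra (X \<times> space N) snd N"
    by (rule measurable_vimage_algebra2) (use x0 in auto)
  from measurable_compose[OF this f] show "(\<lambda>t. f (x0, t)) \<in> borel_measurable N" .
  fix x t assume xt: "x \<in> X" "t \<in> space N"
  have "f -` {f (x0, t)} \<inter> (X \<times> space N) \<in> sets (vimage_algebra (X \<times> space N) snd N)"
    using measurable_sets[OF f, of "{f (x0, t)}"] by simp
  then obtain E where E: "f -` {f (x0, t)} \<inter> (X \<times> space N) = snd -` E \<inter> (X \<times> space N)"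
    by (subst (asm) sets_vimage_algebra2) auto
  have "(x0, t) \<in> snd -` E \<inter> (X \<times> space N)"
    using xt x0 by (subst E[symmetric]) simp
  then have "(x, t) \<in> snd -` E \<inter> (X \<times> space N)" using xt by simp
  then show "f (x, t) = f (x0, t)" by (subst (asm) E[symmetric]) simp
qed

text \<open>
  Conditional expectation is an orthogonal projection of square integrable functions; Jensen's
  inequality keeps it square integrable.
\<close>

lemma (in finite_measure_subalgebra)
  assumes X[measurable]: "X \<in> borel_measurable M" and X2: "integrable M (\<lambda>x. (X x)\<^sup>2)"
  shows integrable_cond_exp_square: "integrable M (\<lambda>x. (real_cond_exp M F X x)\<^sup>2)"
    and integral_cond_exp_square:
      "(\<integral>x. (real_cond_exp M F X x)\<^sup>2 \<partial>M) = (\<integral>x. real_cond_exp M F X x * X x \<partial>M)"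
proof -
  have X1: "integrable M X" by (rule integrable_norm_of_square) (simp_all add: X2)
  show sq: "integrable M (\<lambda>x. (real_cond_exp M F X x)\<^sup>2)"
    by (rule integrable_convex_cond_exp[OF X1, where I=UNIV]) (auto simp: X2 convex_power2)
  have "integrable M (\<lambda>x. real_cond_exp M F X x * X x)"
    using integrable_inner_of_squares[of "real_cond_exp M F X" M X] sq X2 by simp
  from real_cond_exp_intg(2)[OF this]
  show "(\<integral>x. (real_cond_exp M F X x)\<^sup>2 \<partial>M) = (\<integral>x. real_cond_exp M F X x * X x \<partial>M)"
    by (simp add: power2_eq_square)
qed

lemma borel_measurable_componentwise:
  fixes f :: "'a \<Rightarrow> real^'p"
  shows "f \<in> borel_measurable M \<longleftrightarrow> (\<forall>i. (\<lambda>x. f x $ i) \<in> borel_measurable M)"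
  unfolding borel_measurable_euclidean_space[of f] Basis_vec_def by (auto simp: inner_axis)

lemma borel_measurable_component [measurable (raw)]:
  fixes f :: "'a \<Rightarrow> real^'p"
  shows "f \<in> borel_measurable M \<Longrightarrow> (\<lambda>x. f x $ i) \<in> borel_measurable M"
  using borel_measurable_componentwise[of f M] by blast


section \<open>Correlation of the output with one observation\<close>

lemma space_datasets: "space (datasets n M) = {..<n} \<rightarrow>\<^sub>E space M"
  by (simp add: datasets_def space_PiM PiE_def)

text \<open>
  The one consequence of privacy that the argument uses. Nonnegativity of \<open>\<rho>\<close> is a separate
  assumption because it makes the bound \<open>exp (2 \<rho>) - 1\<close> valid for a dataset compared with itself, a
  case that adjacency excludes and that resampling can produce.
\<close>

locale stable_channel = P: prob_space P
  for P :: "'x measure" and N :: "'t measure" and n :: nat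
    and K :: "(nat \<Rightarrow> 'x) \<Rightarrow> 't measure" and \<rho> :: real +
  assumes channel: "K \<in> datasets n P \<rightarrow>\<^sub>M prob_algebra N"
    and rho_nonneg: "0 \<le> \<rho>"
    and renyi_two: "\<And>S S'. S \<in> space (datasets n P) \<Longrightarrow> S' \<in> space (datasets n P) \<Longrightarrow>
      adjacent n S S' \<Longrightarrow> renyi_divergence 2 (K S) (K S') \<le> ereal (2 * \<rho>)"
begin

abbreviation "Q \<equiv> datasets n P"
abbreviation "J \<equiv> kernel_joint Q K N"

sublocale Q: prob_space Q
  unfolding datasets_def by (intro prob_space_PiM P.prob_space_axioms)

sublocale PQ: pair_prob_space P Q ..

sublocale J: prob_space J
  by (rule prob_space_kernel_joint[OF channel Q.prob_space_axioms])

lemma sets_J [measurable_cong]: "sets J = sets (Q \<Otimes>\<^sub>M N)"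
  by (rule sets_kernel_joint[OF channel Q.prob_space_axioms])

lemma measurable_coordinate [measurable]: "k < n \<Longrightarrow> (\<lambda>S. S k) \<in> Q \<rightarrow>\<^sub>M P"
  unfolding datasets_def by measurable

lemma measurable_resample [measurable]: "k < n \<Longrightarrow> (\<lambda>(x, S). S(k := x)) \<in> P \<Otimes>\<^sub>M Q \<rightarrow>\<^sub>M Q"
  unfolding datasets_def split_beta' by (rule measurable_fun_upd[where J="{..<n}"]) auto

lemma distr_resample: "k < n \<Longrightarrow> distr (P \<Otimes>\<^sub>M Q) Q (\<lambda>(x, S). S(k := x)) = Q"
  using distr_pair_PiM_eq_PiM[of "{..<n}" "\<lambda>_. P" k]
  by (simp add: datasets_def P.prob_space_axioms insert_absorb)

lemma distr_coordinate: "k < n \<Longrightarrow> distr Q P (\<lambda>S. S k) = P"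
  unfolding datasets_def using distr_PiM_component[of "{..<n}" "\<lambda>_. P" k]
  by (simp add: P.prob_space_axioms)

lemma integrable_coordinate_J:
  fixes h :: "'x \<Rightarrow> 'b::{banach, second_countable_topology}"
  assumes h: "integrable P h" and k: "k < n"
  shows "integrable J (\<lambda>\<omega>. h (fst \<omega> k))"
proof -
  have hm[measurable]: "h \<in> borel_measurable P" using h by simp
  have "integrable (distr Q P (\<lambda>S. S k)) h" using h by (simp add: distr_coordinate k)
  then have "integrable Q (\<lambda>S. h (S k))"
    using k by (subst (asm) integrable_distr_eq) simp_all
  then have "integrable (distr J Q fst) (\<lambda>S. h (S k))"
    by (simp add: distr_fst_kernel_joint[OF channel Q.prob_space_axioms])
  then show ?thesis
    using k by (subst (asm) integrable_distr_eq) simp_all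
qed

lemma AE_snd: "AE S in Q. R S \<Longrightarrow> AE (x, S) in P \<Otimes>\<^sub>M Q. R S"
proof -
  assume R: "AE S in Q. R S"
  have d: "distr (P \<Otimes>\<^sub>M Q) Q snd = Q"
  proof (rule measure_eqI)
    fix X assume X: "X \<in> sets (distr (P \<Otimes>\<^sub>M Q) Q snd)"
    then have "snd -` X \<inter> space (P \<Otimes>\<^sub>M Q) = space P \<times> X"
      using sets.sets_into_space[of X Q] by (auto simp: space_pair_measure)
    then show "emeasure (distr (P \<Otimes>\<^sub>M Q) Q snd) X = emeasure Q X"
      using X by (simp add: emeasure_distr Q.emeasure_pair_measure_Times P.emeasure_space_1)
  qed simp
  have "AE z in P \<Otimes>\<^sub>M Q. R (snd z)"
    by (rule AE_distrD[where M'=Q]) (simp, subst d, rule R)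
  then show ?thesis by (simp add: case_prod_beta)
qed

lemma AE_resample:
  assumes k: "k < n" and R: "AE S in Q. R S"
  shows "AE (x, S) in P \<Otimes>\<^sub>M Q. R (S(k := x))"
proof -
  have "AE S in distr (P \<Otimes>\<^sub>M Q) Q (\<lambda>(x, S). S(k := x)). R S"
    by (subst distr_resample[OF k]) (rule R)
  from AE_distrD[OF measurable_resample[OF k] this] show ?thesis by (simp add: split_beta')
qed

text \<open>
  If \<open>x\<close> happens to be the old entry, the datasets coincide and the bound reduces to \<open>\<rho> \<ge> 0\<close>.
\<close>

lemma output_difference_bound:
  fixes f :: "'t \<Rightarrow> real"
  assumes S: "S \<in> space Q" and x: "x \<in> space P" and k: "k < n" and l: "0 < l"
    and i: "integrable (K (S(k := x))) f" "integrable (K S) f" "integrable (K S) (\<lambda>t. (f t)\<^sup>2)"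
  shows "(\<integral>t. f t \<partial>K (S(k := x))) - (\<integral>t. f t \<partial>K S)
      \<le> (\<integral>t. (f t)\<^sup>2 \<partial>K S) / (2 * l) + l / 2 * (exp (2 * \<rho>) - 1)"
proof (cases "S k = x")
  case True
  then have "S(k := x) = S" by auto
  then show ?thesis using l rho_nonneg by simp
next
  case False
  have S': "S(k := x) \<in> space Q"
    using S x k by (auto simp: space_datasets PiE_iff extensional_def)
  have "adjacent n (S(k := x)) S"
    unfolding adjacent_def using k False by auto
  from renyi_two[OF S' S this] show ?thesis
    using kernel_space[OF channel S] kernel_space[OF channel S'] i l
    by (intro integral_diff_le_chi_square) auto
qed

text \<open>
  The correlation is the average over \<open>(x, S)\<close> of \<open>b (S(k := x))\<close>, whereas the average of
  \<open>a S \<bullet> s x\<close> vanishes by independence. Subtracting, \<open>output_difference_bound\<close> applies to almost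
  every \<open>(x, S)\<close>, and the average of the remainder \<open>q\<close> is computed with the integral over \<open>x\<close>
  innermost, where \<open>B\<close> controls it.
\<close>

lemma correlation_bound:
  fixes g :: "'t \<Rightarrow> 'v::euclidean_space" and s :: "'x \<Rightarrow> 'v"
  assumes g[measurable]: "g \<in> borel_measurable N" and s[measurable]: "s \<in> borel_measurable P"
    and g2: "integrable J (\<lambda>\<omega>. (norm (g (snd \<omega>)))\<^sup>2)" and s2: "integrable P (\<lambda>x. (norm (s x))\<^sup>2)"
    and s0: "(\<integral>x. s x \<partial>P) = 0" and B: "\<And>v. (\<integral>x. (v \<bullet> s x)\<^sup>2 \<partial>P) \<le> B * (norm v)\<^sup>2"
    and k: "k < n" and l: "0 < l"
  shows "(\<integral>\<omega>. g (snd \<omega>) \<bullet> s (fst \<omega> k) \<partial>J)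
      \<le> B * (\<integral>\<omega>. (norm (g (snd \<omega>)))\<^sup>2 \<partial>J) / (2 * l) + l / 2 * (exp (2 * \<rho>) - 1)"
proof -
  note Qp = Q.prob_space_axioms
  note [measurable] = measurable_prob_algebraD[OF channel]
  \<comment> \<open>Mean outputs: \<open>a\<close> of \<open>g\<close>, \<open>b\<close> of its product with the score of the entry that the dataset
    really contains, \<open>q\<close> of its squared product with the score of an unrelated observation.\<close>
  define a where "a S = (\<integral>t. g t \<partial>K S)" for S
  define b where "b S = (\<integral>t. g t \<bullet> s (S k) \<partial>K S)" for S
  define q where "q x S = (\<integral>t. (g t \<bullet> s x)\<^sup>2 \<partial>K S)" for x S
  define \<tau> where "\<tau> = (\<integral>\<omega>. (norm (g (snd \<omega>)))\<^sup>2 \<partial>J)"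
  have gK: "g \<in> borel_measurable (K S)" if "S \<in> space Q" for S
    using g by (simp add: measurable_cong_sets[OF kernel_space(2)[OF channel that] refl])
  have s1: "integrable P s" by (rule P.integrable_norm_of_square[OF s s2])
  have s2k: "integrable J (\<lambda>\<omega>. (norm (s (fst \<omega> k)))\<^sup>2)"
    by (rule integrable_coordinate_J[OF s2 k])
  have mk[measurable]: "(\<lambda>\<omega>. s (fst \<omega> k)) \<in> borel_measurable (Q \<Otimes>\<^sub>M N)"
    using k by measurable
  have fJ: "integrable J (\<lambda>\<omega>. g (snd \<omega>) \<bullet> s (fst \<omega> k))"
    by (rule integrable_inner_of_squares[OF _ _ g2 s2k]) measurable
  have gJ: "integrable J (\<lambda>\<omega>. g (snd \<omega>))"
    by (rule J.integrable_norm_of_square[OF _ g2]) measurable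
  have b_int: "integrable Q b" and b_eq: "(\<integral>\<omega>. g (snd \<omega>) \<bullet> s (fst \<omega> k) \<partial>J) = (\<integral>S. b S \<partial>Q)"
    using integrable_kernel_joint[OF channel Qp fJ] integral_kernel_joint[OF channel Qp fJ]
    by (simp_all add: b_def[abs_def])
  have b_res: "integrable (P \<Otimes>\<^sub>M Q) (\<lambda>(x, S). b (S(k := x)))"
    "(\<integral>(x, S). b (S(k := x)) \<partial>(P \<Otimes>\<^sub>M Q)) = (\<integral>S. b S \<partial>Q)"
  proof -
    have bm: "b \<in> borel_measurable Q" using b_int by simp
    show "integrable (P \<Otimes>\<^sub>M Q) (\<lambda>(x, S). b (S(k := x)))"
      using integrable_distr_eq[OF measurable_resample[OF k] bm] b_int
      by (simp add: distr_resample[OF k]) (simp add: split_beta')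
    show "(\<integral>(x, S). b (S(k := x)) \<partial>(P \<Otimes>\<^sub>M Q)) = (\<integral>S. b S \<partial>Q)"
      using integral_distr[OF measurable_resample[OF k] bm]
      by (simp add: distr_resample[OF k]) (simp add: split_beta')
  qed
  have am[measurable]: "a \<in> borel_measurable Q"
    using integral_measurable_kernel[OF channel, of "\<lambda>\<omega>. g (snd \<omega>)"] by (simp add: a_def[abs_def])
  have a_int: "integrable Q a"
  proof (rule Bochner_Integration.integrable_bound[OF _ am])
    show "integrable Q (\<lambda>S. \<integral>t. norm (g t) \<partial>K S)"
      using integrable_kernel_joint[OF channel Qp integrable_norm[OF gJ]] by simp
    show "AE S in Q. norm (a S) \<le> norm (\<integral>t. norm (g t) \<partial>K S)"
      by (intro AE_I2) (auto simp: a_def intro: order_trans[OF integral_norm_bound])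
  qed
  have as_int: "integrable (P \<Otimes>\<^sub>M Q) (\<lambda>(x, S). a S \<bullet> s x)"
  proof (rule Bochner_Integration.integrable_bound)
    show "integrable (P \<Otimes>\<^sub>M Q) (\<lambda>(x, S). norm (s x) * norm (a S))"
      by (rule PQ.Fubini_integrable) (use s1 a_int in \<open>auto simp: abs_mult\<close>)
    show "AE z in P \<Otimes>\<^sub>M Q. norm (case z of (x, S) \<Rightarrow> a S \<bullet> s x)
        \<le> norm (case z of (x, S) \<Rightarrow> norm (s x) * norm (a S))"
      using Cauchy_Schwarz_ineq2 by (intro AE_I2) (auto simp: mult.commute abs_mult)
  qed measurable
  have as_zero: "(\<integral>(x, S). a S \<bullet> s x \<partial>(P \<Otimes>\<^sub>M Q)) = 0"
    using PQ.integral_snd[OF as_int] s1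
    by (simp add: case_prod_beta s0)
  have qb: "integrable (P \<Otimes>\<^sub>M Q) (\<lambda>(x, S). q x S)" "(\<integral>(x, S). q x S \<partial>(P \<Otimes>\<^sub>M Q)) \<le> B * \<tau>"
  proof -
    have Bpos: "0 \<le> B * (norm v)\<^sup>2" for v :: 'v
      by (rule order_trans[OF _ B[of v]]) simp
    have qm[measurable]: "(\<lambda>(x, S). q x S) \<in> borel_measurable (P \<Otimes>\<^sub>M Q)"
    proof -
      have c: "(\<lambda>z. K (snd z)) \<in> (P \<Otimes>\<^sub>M Q) \<rightarrow>\<^sub>M prob_algebra N"
        using channel by measurable
      show ?thesis
        using integral_measurable_kernel[OF c, of "\<lambda>(z, t). (g t \<bullet> s (fst z))\<^sup>2"]
        by (simp add: q_def case_prod_beta)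
    qed
    have qnm: "(\<lambda>(x, S). \<integral>\<^sup>+t. ennreal ((g t \<bullet> s x)\<^sup>2) \<partial>K S) \<in> borel_measurable (P \<Otimes>\<^sub>M Q)"
      using nn_integral_measurable_subprob_algebra2[of "\<lambda>z t. ennreal ((g t \<bullet> s (fst z))\<^sup>2)" "P \<Otimes>\<^sub>M Q" N "\<lambda>z. K (snd z)"]
      by (simp add: case_prod_beta)
    have q0: "0 \<le> q x S" for x S by (simp add: q_def)
    have q_le: "ennreal (q x S) \<le> (\<integral>\<^sup>+t. ennreal ((g t \<bullet> s x)\<^sup>2) \<partial>K S)" if "S \<in> space Q" for x S
      unfolding q_def using gK[OF that]
      by (subst integral_eq_nn_integral) (auto simp: ennreal_enn2real_if)
    have "(\<integral>\<^sup>+(x, S). ennreal (q x S) \<partial>(P \<Otimes>\<^sub>M Q))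
        \<le> (\<integral>\<^sup>+(x, S). \<integral>\<^sup>+t. ennreal ((g t \<bullet> s x)\<^sup>2) \<partial>K S \<partial>(P \<Otimes>\<^sub>M Q))"
      by (intro nn_integral_mono) (auto simp: space_pair_measure q_le)
    also have "\<dots> = (\<integral>\<^sup>+S. \<integral>\<^sup>+x. \<integral>\<^sup>+t. ennreal ((g t \<bullet> s x)\<^sup>2) \<partial>K S \<partial>P \<partial>Q)"
      using PQ.nn_integral_snd[OF qnm] by simp
    also have "\<dots> \<le> (\<integral>\<^sup>+S. \<integral>\<^sup>+t. ennreal (B * (norm (g t))\<^sup>2) \<partial>K S \<partial>Q)"
    proof (rule nn_integral_mono)
      fix S assume S: "S \<in> space Q"
      interpret KS: prob_space "K S" by (rule kernel_space(1)[OF channel S])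
      interpret pair_sigma_finite P "K S" ..
      note [measurable] = gK[OF S]
      have "(\<integral>\<^sup>+x. \<integral>\<^sup>+t. ennreal ((g t \<bullet> s x)\<^sup>2) \<partial>K S \<partial>P) = (\<integral>\<^sup>+t. \<integral>\<^sup>+x. ennreal ((g t \<bullet> s x)\<^sup>2) \<partial>P \<partial>K S)"
        by (rule Fubini'[symmetric]) measurable
      also have "\<dots> \<le> (\<integral>\<^sup>+t. ennreal (B * (norm (g t))\<^sup>2) \<partial>K S)"
      proof (rule nn_integral_mono)
        fix t
        have "integrable P (\<lambda>x. (g t \<bullet> s x)\<^sup>2)"
        proof (rule Bochner_Integration.integrable_bound)
          show "integrable P (\<lambda>x. (norm (g t))\<^sup>2 * (norm (s x))\<^sup>2)" using s2 by simp
          show "AE x in P. norm ((g t \<bullet> s x)\<^sup>2) \<le> norm ((norm (g t))\<^sup>2 * (norm (s x))\<^sup>2)"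
            using Cauchy_Schwarz_ineq[of "g t"] by (intro AE_I2) (simp add: power2_norm_eq_inner)
        qed measurable
        then show "(\<integral>\<^sup>+x. ennreal ((g t \<bullet> s x)\<^sup>2) \<partial>P) \<le> ennreal (B * (norm (g t))\<^sup>2)"
          by (subst nn_integral_eq_integral) (auto intro: ennreal_leI B)
      qed
      finally show "(\<integral>\<^sup>+x. \<integral>\<^sup>+t. ennreal ((g t \<bullet> s x)\<^sup>2) \<partial>K S \<partial>P) \<le> (\<integral>\<^sup>+t. ennreal (B * (norm (g t))\<^sup>2) \<partial>K S)" .
    qed
    also have "\<dots> = (\<integral>\<^sup>+\<omega>. ennreal (B * (norm (g (snd \<omega>)))\<^sup>2) \<partial>J)"
      by (subst nn_integral_kernel_joint[OF channel Qp]) simp_all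
    also have "\<dots> = ennreal (B * \<tau>)"
      unfolding \<tau>_def using g2 by (subst nn_integral_eq_integral) (simp_all add: Bpos)
    finally have le: "(\<integral>\<^sup>+z. ennreal (case z of (x, S) \<Rightarrow> q x S) \<partial>(P \<Otimes>\<^sub>M Q)) \<le> ennreal (B * \<tau>)"
      by (simp add: split_beta')
    show qi: "integrable (P \<Otimes>\<^sub>M Q) (\<lambda>(x, S). q x S)"
      by (rule integrableI_nonneg[OF qm]) (use q0 le in \<open>auto simp: less_top[symmetric] top_unique\<close>)
    have "0 \<le> B * \<tau>"
      unfolding \<tau>_def using integral_nonneg_AE[of "\<lambda>\<omega>. B * (norm (g (snd \<omega>)))\<^sup>2" J] Bpos by simp
    then show "(\<integral>(x, S). q x S \<partial>(P \<Otimes>\<^sub>M Q)) \<le> B * \<tau>"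
      using le q0 by (subst (asm) nn_integral_eq_integral[OF qi]) (auto simp: case_prod_beta)
  qed
  have "AE S in Q. integrable (K S) (\<lambda>t. (norm (g t))\<^sup>2)"
    using AE_integrable_kernel_joint[OF channel Qp g2] by simp
  then have good: "AE (x, S) in P \<Otimes>\<^sub>M Q. integrable (K S) (\<lambda>t. (norm (g t))\<^sup>2)"
    "AE (x, S) in P \<Otimes>\<^sub>M Q. integrable (K (S(k := x))) (\<lambda>t. (norm (g t))\<^sup>2)"
    by (rule AE_snd, rule AE_resample[OF k])
  have pointwise: "AE (x, S) in P \<Otimes>\<^sub>M Q.
      b (S(k := x)) - a S \<bullet> s x \<le> q x S / (2 * l) + l / 2 * (exp (2 * \<rho>) - 1)"
    using good AE_space
  proof eventually_elim
    case (elim z)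
    obtain x S where z: "z = (x, S)" by (cases z)
    have S: "S \<in> space Q" and x: "x \<in> space P"
      and i1: "integrable (K S) (\<lambda>t. (norm (g t))\<^sup>2)"
      and i2: "integrable (K (S(k := x))) (\<lambda>t. (norm (g t))\<^sup>2)"
      using elim by (auto simp: z space_pair_measure)
    have S': "S(k := x) \<in> space Q"
      using S x k by (auto simp: space_datasets PiE_iff extensional_def)
    interpret K: prob_space "K S" by (rule kernel_space(1)[OF channel S])
    interpret K': prob_space "K (S(k := x))" by (rule kernel_space(1)[OF channel S'])
    have g1: "integrable (K S) g" by (rule K.integrable_norm_of_square[OF gK[OF S] i1])
    have g1': "integrable (K (S(k := x))) g" by (rule K'.integrable_norm_of_square[OF gK[OF S'] i2])
    have sq: "integrable (K S) (\<lambda>t. (g t \<bullet> s x)\<^sup>2)"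
    proof (rule Bochner_Integration.integrable_bound)
      show "integrable (K S) (\<lambda>t. (norm (g t))\<^sup>2 * (norm (s x))\<^sup>2)" using i1 by simp
      show "AE t in K S. norm ((g t \<bullet> s x)\<^sup>2) \<le> norm ((norm (g t))\<^sup>2 * (norm (s x))\<^sup>2)"
        using Cauchy_Schwarz_ineq[of _ "s x"] by (intro AE_I2) (simp add: power2_norm_eq_inner)
    qed (use gK[OF S] in measurable)
    have "b (S(k := x)) = (\<integral>t. g t \<bullet> s x \<partial>K (S(k := x)))" by (simp add: b_def)
    moreover have "a S \<bullet> s x = (\<integral>t. g t \<bullet> s x \<partial>K S)" using g1 by (simp add: a_def)
    ultimately show ?case
      using output_difference_bound[OF S x k l, of "\<lambda>t. g t \<bullet> s x"] g1 g1' sq by (simp add: z q_def)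
  qed
  have "(\<integral>S. b S \<partial>Q) = (\<integral>z. (case z of (x, S) \<Rightarrow> b (S(k := x))) - (case z of (x, S) \<Rightarrow> a S \<bullet> s x) \<partial>(P \<Otimes>\<^sub>M Q))"
    by (subst Bochner_Integration.integral_diff[OF b_res(1) as_int]) (simp only: b_res(2) as_zero diff_0_right)
  also have "\<dots> \<le> (\<integral>z. (case z of (x, S) \<Rightarrow> q x S) / (2 * l) + l / 2 * (exp (2 * \<rho>) - 1) \<partial>(P \<Otimes>\<^sub>M Q))"
  proof (rule integral_mono_AE)
    show "integrable (P \<Otimes>\<^sub>M Q)
        (\<lambda>z. (case z of (x, S) \<Rightarrow> b (S(k := x))) - (case z of (x, S) \<Rightarrow> a S \<bullet> s x))"
      by (rule Bochner_Integration.integrable_diff[OF b_res(1) as_int])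
    show "integrable (P \<Otimes>\<^sub>M Q) (\<lambda>z. (case z of (x, S) \<Rightarrow> q x S) / (2 * l) + l / 2 * (exp (2 * \<rho>) - 1))"
      by (intro Bochner_Integration.integrable_add integrable_divide qb(1)) simp
  qed (use pointwise in \<open>simp add: split_beta'\<close>)
  also have "\<dots> = (\<integral>(x, S). q x S \<partial>(P \<Otimes>\<^sub>M Q)) / (2 * l) + l / 2 * (exp (2 * \<rho>) - 1)"
    by (subst Bochner_Integration.integral_add[OF integrable_divide[OF qb(1)]]) (simp_all add: PQ.prob_space)
  also have "\<dots> \<le> B * \<tau> / (2 * l) + l / 2 * (exp (2 * \<rho>) - 1)"
    using qb(2) l by (simp add: divide_right_mono)
  finally show ?thesis using b_eq by (simp add: \<tau>_def)
qed

end


section \<open>Information of the output\<close>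

context stable_channel
begin

text \<open>
  The output score of the joint law, for a score \<open>s\<close> at a single parameter value.
\<close>

definition conditional_score :: "('x \<Rightarrow> real^'p) \<Rightarrow> (nat \<Rightarrow> 'x) \<times> 't \<Rightarrow> real^'p" where
  "conditional_score s \<omega> =
    (\<chi> i. real_cond_exp J (vimage_algebra (space J) snd N) (\<lambda>(S, t). (\<Sum>k<n. s (S k)) $ i) \<omega>)"

text \<open>
  The projection identity turns the information \<open>\<tau>\<close> into the sum of the correlations of the output
  with the observations, each bounded by \<open>correlation_bound\<close> with one \<open>l\<close> for all of them. The bound
  contains \<open>\<tau>\<close> itself, and \<open>l\<close> is chosen to absorb half of it.
\<close>

lemma conditional_score_information:
  fixes s :: "'x \<Rightarrow> real^'p"
  assumes s[measurable]: "s \<in> borel_measurable P" and s2: "integrable P (\<lambda>x. (norm (s x))\<^sup>2)"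
    and s0: "(\<integral>x. s x \<partial>P) = 0" and B: "\<And>v. (\<integral>x. (v \<bullet> s x)\<^sup>2 \<partial>P) \<le> B * (norm v)\<^sup>2"
    and B0: "0 \<le> B"
  shows "(\<Sum>i\<in>UNIV. \<integral>\<omega>. conditional_score s \<omega> $ i * conditional_score s \<omega> $ i \<partial>J)
      \<le> (exp (2 * \<rho>) - 1) * (real n)\<^sup>2 * B"
proof -
  define F where "F = vimage_algebra (space J) snd N"
  define X where "X \<omega> = (\<Sum>k<n. s (fst \<omega> k))" for \<omega> :: "(nat \<Rightarrow> 'x) \<times> 't"
  have spJ: "space J = space Q \<times> space N"
    using sets_eq_imp_space_eq[OF sets_J] by (simp add: space_pair_measure)
  have snd_F: "snd \<in> F \<rightarrow>\<^sub>M N"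
    unfolding F_def by (rule measurable_vimage_algebra1) (auto simp: spJ)
  have sub: "subalgebra J F"
    unfolding subalgebra_def F_def by (intro conjI sets_image_in_sets) (simp, simp, measurable)
  interpret finite_measure_subalgebra J F
    by unfold_locales (rule sub)
  have sk: "(\<lambda>\<omega>. s (fst \<omega> k)) \<in> borel_measurable J" "integrable J (\<lambda>\<omega>. (norm (s (fst \<omega> k)))\<^sup>2)"
    if "k < n" for k
    using integrable_coordinate_J[OF s2 that] that by measurable
  have Xm[measurable]: "X \<in> borel_measurable J"
    unfolding X_def using sk(1) by (intro borel_measurable_sum) auto
  have X2: "integrable J (\<lambda>\<omega>. (norm (X \<omega>))\<^sup>2)"
  proof -
    have "(norm (X \<omega>))\<^sup>2 = (\<Sum>k<n. \<Sum>m<n. s (fst \<omega> k) \<bullet> s (fst \<omega> m))" for \<omega>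
      unfolding power2_norm_eq_inner X_def inner_sum_left inner_sum_right by (rule sum.swap)
    moreover have "integrable J (\<lambda>\<omega>. \<Sum>k<n. \<Sum>m<n. s (fst \<omega> k) \<bullet> s (fst \<omega> m))"
      by (intro Bochner_Integration.integrable_sum integrable_inner_of_squares sk) auto
    ultimately show ?thesis by simp
  qed
  have Xi2: "integrable J (\<lambda>\<omega>. (X \<omega> $ i)\<^sup>2)" for i
  proof (rule Bochner_Integration.integrable_bound[OF X2])
    show "AE \<omega> in J. norm ((X \<omega> $ i)\<^sup>2) \<le> norm ((norm (X \<omega>))\<^sup>2)"
      using component_le_norm_cart[of _ i] by (intro AE_I2) (simp add: abs_le_square_iff[symmetric])
  qed measurable
  define h where "h = conditional_score s"
  have h_eq: "h \<omega> $ i = real_cond_exp J F (\<lambda>\<omega>. X \<omega> $ i) \<omega>" for \<omega> i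
    by (simp add: h_def conditional_score_def F_def X_def split_beta')
  have hF[measurable]: "h \<in> borel_measurable F"
    by (subst borel_measurable_componentwise) (simp add: h_eq)
  obtain S0 where S0: "S0 \<in> space Q" using Q.not_empty by auto
  define g where "g t = h (S0, t)" for t
  have hF': "h \<in> borel_measurable (vimage_algebra (space Q \<times> space N) snd N)"
    using hF by (simp add: F_def spJ)
  have gm[measurable]: "g \<in> borel_measurable N"
    using vimage_snd_factorization(1)[OF hF' S0] by (simp add: g_def[abs_def])
  have hg: "h \<omega> = g (snd \<omega>)" if "\<omega> \<in> space J" for \<omega>
    using that vimage_snd_factorization(2)[OF hF' S0] by (auto simp: g_def spJ)
  have hi2: "integrable J (\<lambda>\<omega>. (h \<omega> $ i)\<^sup>2)" for i
    unfolding h_eq by (rule integrable_cond_exp_square[OF _ Xi2]) measurable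
  have nrm: "(norm v)\<^sup>2 = (\<Sum>i\<in>UNIV. (v $ i)\<^sup>2)" for v :: "real^'p"
    unfolding power2_norm_eq_inner inner_vec_def by (simp add: power2_eq_square)
  have g2: "integrable J (\<lambda>\<omega>. (norm (g (snd \<omega>)))\<^sup>2)"
  proof -
    have "integrable J (\<lambda>\<omega>. (norm (h \<omega>))\<^sup>2)" unfolding nrm using hi2 by simp
    also have "?this \<longleftrightarrow> integrable J (\<lambda>\<omega>. (norm (g (snd \<omega>)))\<^sup>2)"
      by (intro Bochner_Integration.integrable_cong) (simp_all add: hg)
    finally show ?thesis .
  qed
  define \<tau> where "\<tau> = (\<integral>\<omega>. (norm (g (snd \<omega>)))\<^sup>2 \<partial>J)"
  have trace: "(\<Sum>i\<in>UNIV. \<integral>\<omega>. conditional_score s \<omega> $ i * conditional_score s \<omega> $ i \<partial>J) = \<tau>"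
  proof -
    have "(\<Sum>i\<in>UNIV. \<integral>\<omega>. h \<omega> $ i * h \<omega> $ i \<partial>J) = (\<integral>\<omega>. (norm (h \<omega>))\<^sup>2 \<partial>J)"
      unfolding nrm using hi2 by (simp add: power2_eq_square)
    also have "\<dots> = \<tau>" unfolding \<tau>_def by (intro Bochner_Integration.integral_cong) (simp_all add: hg)
    finally show ?thesis by (simp add: h_def)
  qed
  have gi: "integrable J (\<lambda>\<omega>. g (snd \<omega>) \<bullet> s (fst \<omega> k))" if "k < n" for k
    by (rule integrable_inner_of_squares[OF _ sk(1)[OF that] g2 sk(2)[OF that]]) measurable
  have "\<tau> = (\<Sum>i\<in>UNIV. \<integral>\<omega>. h \<omega> $ i * X \<omega> $ i \<partial>J)"
    unfolding trace[symmetric] h_def[symmetric]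
    using integral_cond_exp_square[OF _ Xi2] by (simp add: h_eq power2_eq_square)
  also have "\<dots> = (\<integral>\<omega>. h \<omega> \<bullet> X \<omega> \<partial>J)"
  proof -
    have "integrable J (\<lambda>\<omega>. h \<omega> $ i * X \<omega> $ i)" for i
      using integrable_inner_of_squares[of "\<lambda>\<omega>. h \<omega> $ i" J "\<lambda>\<omega>. X \<omega> $ i"] hi2[of i] Xi2[of i]
        measurable_from_subalg[OF sub hF] by simp
    then show ?thesis by (simp add: inner_vec_def)
  qed
  also have "\<dots> = (\<integral>\<omega>. (\<Sum>k<n. g (snd \<omega>) \<bullet> s (fst \<omega> k)) \<partial>J)"
    by (intro Bochner_Integration.integral_cong) (simp_all add: hg X_def inner_sum_right)
  also have "\<dots> = (\<Sum>k<n. \<integral>\<omega>. g (snd \<omega>) \<bullet> s (fst \<omega> k) \<partial>J)"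
    using gi by (intro Bochner_Integration.integral_sum) auto
  finally have sum: "\<tau> = (\<Sum>k<n. \<integral>\<omega>. g (snd \<omega>) \<bullet> s (fst \<omega> k) \<partial>J)" .
  define c where "c = exp (2 * \<rho>) - 1"
  have c0: "0 \<le> c" using rho_nonneg by (simp add: c_def)
  have main: "\<tau> \<le> real n * (B * \<tau> / (2 * l) + l / 2 * c)" if "0 < l" for l
  proof -
    have "(\<Sum>k<n. \<integral>\<omega>. g (snd \<omega>) \<bullet> s (fst \<omega> k) \<partial>J) \<le> (\<Sum>k<n. B * \<tau> / (2 * l) + l / 2 * c)"
      unfolding \<tau>_def c_def by (intro sum_mono correlation_bound[OF gm s g2 s2 s0 B _ that]) simp
    then show ?thesis using sum by simp
  qed
  have "\<tau> \<le> c * (real n)\<^sup>2 * B"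
  proof (cases "n = 0 \<or> B = 0")
    case True
    have "\<tau> \<le> 0"
    proof (rule ccontr)
      assume "\<not> \<tau> \<le> 0"
      then have t: "0 < \<tau>" by simp
      then have n: "0 < n" using sum by (cases "n = 0") simp_all
      then have B: "B = 0" using True by simp
      \<comment> \<open>With \<open>B = 0\<close> what remains is \<open>\<tau> \<le> n l c / 2\<close> for all \<open>l\<close>; this \<open>l\<close> makes the right side
        smaller than \<open>\<tau>\<close>, also when \<open>c = 0\<close>.\<close>
      define l where "l = \<tau> / (real n * (c + 1))"
      have l: "0 < l" using t n c0 by (simp add: l_def)
      have "real n * l * (c + 1) = \<tau>" using n c0 by (simp add: l_def)
      moreover have "\<tau> \<le> real n * l * c / 2" using main[OF l] B by simp
      moreover have "0 < real n * l" "0 \<le> real n * l * c" using n l c0 by simp_all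
      ultimately show False by (simp add: algebra_simps)
    qed
    also have "0 \<le> c * (real n)\<^sup>2 * B" using c0 B0 by simp
    finally show ?thesis .
  next
    case False
    then have l: "0 < real n * B" using B0 by simp
    have "real n * (B * \<tau> / (2 * (real n * B)) + (real n * B) / 2 * c) = \<tau> / 2 + c * (real n)\<^sup>2 * B / 2"
      using False by (simp add: field_simps power2_eq_square)
    with main[OF l] show ?thesis by simp
  qed
  then show ?thesis by (simp add: trace c_def)
qed

end


section \<open>Square integrable scores in a regular model\<close>

lemma measurable_section_restrict_space:
  assumes s: "case_prod s \<in> borel_measurable (M \<Otimes>\<^sub>M restrict_space borel \<Theta>)" and \<theta>: "\<theta> \<in> \<Theta>"
  shows "(\<lambda>x. s x \<theta>) \<in> borel_measurable M"
  using measurable_compose[OF measurable_Pair2'[of \<theta> "restrict_space borel \<Theta>" M] s] \<theta>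
  by (simp add: space_restrict_space)

lemma square_le_three_squares: "(a - b - c)\<^sup>2 \<le> 3 * (a\<^sup>2 + b\<^sup>2 + c\<^sup>2)" for a b c :: real
proof -
  have "3 * (a\<^sup>2 + b\<^sup>2 + c\<^sup>2) - (a - b - c)\<^sup>2 = (a + b)\<^sup>2 + (a + c)\<^sup>2 + (b - c)\<^sup>2"
    by (simp add: power2_eq_square algebra_simps)
  then show ?thesis using zero_le_power2[of "a + b"] zero_le_power2[of "a + c"] zero_le_power2[of "b - c"] by linarith
qed

context regular_model
begin

lemma integrable_density: "\<eta> \<in> \<Theta> \<Longrightarrow> integrable M (p \<eta>)"
proof -
  assume \<eta>: "\<eta> \<in> \<Theta>"
  interpret law: prob_space "law M p \<eta>" by (rule law_prob_space[OF \<eta>])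
  have "(\<integral>\<^sup>+x. ennreal (p \<eta> x) \<partial>M) = emeasure (law M p \<eta>) (space (law M p \<eta>))"
    using density_measurable[OF \<eta>]
    by (simp add: law_def emeasure_density nn_integral_set_ennreal cong: nn_integral_cong)
  then have "(\<integral>\<^sup>+x. ennreal (p \<eta> x) \<partial>M) < \<infinity>" by (simp add: law.emeasure_space_1)
  then show ?thesis
    using density_measurable[OF \<eta>] density_nonneg[OF \<eta>]
    by (intro integrableI_nonneg) auto
qed

lemma measurable_score: "\<theta> \<in> \<Theta> \<Longrightarrow> (\<lambda>x. s x \<theta>) \<in> borel_measurable M"
  by (rule measurable_section_restrict_space[OF score_measurable])

text \<open>
  Differentiability in quadratic mean says that \<open>(h \<bullet> s) \<surd>p / 2\<close> is, up to a remainder that is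
  square integrable for small \<open>h\<close>, the difference of the roots of two densities, which is square
  integrable. A small multiple of a basis vector as \<open>h\<close> isolates one component of the score; the
  parameter stays in \<open>\<Theta>\<close> because it starts in the interior.
\<close>

lemma integrable_score_square:
  assumes \<theta>: "\<theta> \<in> interior \<Theta>"
  shows "integrable (law M p \<theta>) (\<lambda>x. (norm (s x \<theta>))\<^sup>2)"
proof -
  have \<theta>': "\<theta> \<in> \<Theta>" using \<theta> interior_subset by blast
  note [measurable] = measurable_score[OF \<theta>'] density_measurable[OF \<theta>']
  define R where "R h x = sqrt (p (\<theta> + h) x) - sqrt (p \<theta> x) - (h \<bullet> s x \<theta>) * sqrt (p \<theta> x) / 2" for h x
  have "((\<lambda>h. (\<integral>\<^sup>+x. ennreal ((R h x)\<^sup>2) \<partial>M) / ennreal ((norm h)\<^sup>2)) \<longlongrightarrow> 0) (at 0)"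
    using DQM[OF \<theta>] by (simp add: DQM_at_def R_def)
  then have ev1: "\<forall>\<^sub>F h in at 0. (\<integral>\<^sup>+x. ennreal ((R h x)\<^sup>2) \<partial>M) / ennreal ((norm h)\<^sup>2) < 1"
    by (rule order_tendstoD) simp
  obtain d1 where d1: "0 < d1"
    "\<And>h. h \<noteq> 0 \<Longrightarrow> norm h < d1 \<Longrightarrow> (\<integral>\<^sup>+x. ennreal ((R h x)\<^sup>2) \<partial>M) / ennreal ((norm h)\<^sup>2) < 1"
    using ev1 unfolding eventually_at by (auto simp: dist_norm)
  obtain d2 where d2: "0 < d2" "ball \<theta> d2 \<subseteq> \<Theta>"
    using \<theta> by (auto simp: mem_interior)
  define d where "d = min d1 d2 / 2"
  have d: "0 < d" "d < d1" "d < d2" using d1(1) d2(1) by (auto simp: d_def)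
  have comp: "integrable M (\<lambda>x. p \<theta> x * (s x \<theta> $ i)\<^sup>2)" for i
  proof -
    define h where "h = axis i d"
    have h: "norm h = d" "h \<noteq> 0" using d by (auto simp: h_def axis_eq_0_iff norm_eq_sqrt_inner inner_axis_axis real_sqrt_mult_self)
    have \<eta>: "\<theta> + h \<in> \<Theta>" using d2(2) h d by (auto simp: dist_norm subset_iff)
    note [measurable] = density_measurable[OF \<eta>]
    have Rm[measurable]: "R h \<in> borel_measurable M" unfolding R_def by measurable
    have R2: "integrable M (\<lambda>x. (R h x)\<^sup>2)"
    proof (rule integrableI_nonneg)
      have "(\<integral>\<^sup>+x. ennreal ((R h x)\<^sup>2) \<partial>M) \<noteq> \<infinity>"
      proof
        assume "(\<integral>\<^sup>+x. ennreal ((R h x)\<^sup>2) \<partial>M) = \<infinity>"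
        with d1(2)[of h] h d show False by (simp add: ennreal_top_divide)
      qed
      then show "(\<integral>\<^sup>+x. ennreal ((R h x)\<^sup>2) \<partial>M) < \<infinity>" by (simp add: less_top)
    qed auto
    show ?thesis
    proof (rule Bochner_Integration.integrable_bound)
      \<comment> \<open>\<open>12 = 3 \<cdot> 4\<close>: the factor of the three squares, and the square of the \<open>2\<close> that divides the
        score in the expansion of the root density.\<close>
      show "integrable M (\<lambda>x. 12 / d\<^sup>2 * (p (\<theta> + h) x + p \<theta> x + (R h x)\<^sup>2))"
        using R2 integrable_density[OF \<eta>] integrable_density[OF \<theta>'] by simp
      show "AE x in M. norm (p \<theta> x * (s x \<theta> $ i)\<^sup>2) \<le> norm (12 / d\<^sup>2 * (p (\<theta> + h) x + p \<theta> x + (R h x)\<^sup>2))"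
      proof (rule AE_I2)
        fix x assume x: "x \<in> space M"
        have p0: "0 \<le> p \<theta> x" "0 \<le> p (\<theta> + h) x"
          using density_nonneg[OF \<theta>' x] density_nonneg[OF \<eta> x] by auto
        have "h \<bullet> s x \<theta> = d * (s x \<theta> $ i)" by (simp add: h_def inner_axis')
        then have "d * (s x \<theta> $ i) * sqrt (p \<theta> x) / 2 = sqrt (p (\<theta> + h) x) - sqrt (p \<theta> x) - R h x"
          by (simp add: R_def)
        then have "(d * (s x \<theta> $ i) * sqrt (p \<theta> x) / 2)\<^sup>2
            = (sqrt (p (\<theta> + h) x) - sqrt (p \<theta> x) - R h x)\<^sup>2" by (rule arg_cong)
        also have "\<dots> \<le> 3 * (p (\<theta> + h) x + p \<theta> x + (R h x)\<^sup>2)"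
          using square_le_three_squares[of "sqrt (p (\<theta> + h) x)" "sqrt (p \<theta> x)" "R h x"] p0 by simp
        finally have le: "(d * (s x \<theta> $ i) * sqrt (p \<theta> x) / 2)\<^sup>2 \<le> 3 * (p (\<theta> + h) x + p \<theta> x + (R h x)\<^sup>2)" .
        have eq: "(d * (s x \<theta> $ i) * sqrt (p \<theta> x) / 2)\<^sup>2 = d\<^sup>2 / 4 * (p \<theta> x * (s x \<theta> $ i)\<^sup>2)"
          using p0 by (simp add: power_mult_distrib power_divide)
        have "y \<le> 12 / d\<^sup>2 * z" if "d\<^sup>2 / 4 * y \<le> 3 * z" for y z
          using that d by (simp add: field_simps)
        from this[OF le[unfolded eq]]
        have "p \<theta> x * (s x \<theta> $ i)\<^sup>2 \<le> 12 / d\<^sup>2 * (p (\<theta> + h) x + p \<theta> x + (R h x)\<^sup>2)" .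
        then show "norm (p \<theta> x * (s x \<theta> $ i)\<^sup>2) \<le> norm (12 / d\<^sup>2 * (p (\<theta> + h) x + p \<theta> x + (R h x)\<^sup>2))"
          using p0 d by simp
      qed
    qed measurable
  qed
  have "integrable (law M p \<theta>) (\<lambda>x. (s x \<theta> $ i)\<^sup>2)" for i
    unfolding law_def using comp[of i] density_nonneg[OF \<theta>']
    by (subst Bochner_Integration.integrable_density) auto
  then show ?thesis
    unfolding power2_norm_eq_inner inner_vec_def by (simp add: power2_eq_square)
qed

lemma score_quadratic_form_le:
  assumes \<theta>: "\<theta> \<in> interior \<Theta>"
  shows "(\<integral>x. (v \<bullet> s x \<theta>)\<^sup>2 \<partial>law M p \<theta>) \<le> spectral_norm (sample_information M p s \<theta>) * (norm v)\<^sup>2"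
proof -
  let ?I = "sample_information M p s \<theta>"
  have \<theta>': "\<theta> \<in> \<Theta>" using \<theta> interior_subset by blast
  have sm[measurable]: "(\<lambda>x. s x \<theta>) \<in> borel_measurable (law M p \<theta>)"
    using measurable_score[OF \<theta>'] by (simp add: law_def)
  have i2: "integrable (law M p \<theta>) (\<lambda>x. (s x \<theta> $ i)\<^sup>2)" for i
  proof (rule Bochner_Integration.integrable_bound[OF integrable_score_square[OF \<theta>]])
    show "AE x in law M p \<theta>. norm ((s x \<theta> $ i)\<^sup>2) \<le> norm ((norm (s x \<theta>))\<^sup>2)"
      using component_le_norm_cart[of _ i] by (intro AE_I2) (simp add: abs_le_square_iff[symmetric])
  qed measurable
  have ij: "integrable (law M p \<theta>) (\<lambda>x. s x \<theta> $ i * s x \<theta> $ j)" for i j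
    using integrable_inner_of_squares[of "\<lambda>x. s x \<theta> $ i" "law M p \<theta>" "\<lambda>x. s x \<theta> $ j"] i2[of i] i2[of j]
    by simp
  have sq: "(v \<bullet> s x \<theta>)\<^sup>2 = (\<Sum>i\<in>UNIV. \<Sum>j\<in>UNIV. v $ i * v $ j * (s x \<theta> $ i * s x \<theta> $ j))" for x
    unfolding power2_eq_square inner_vec_def sum_product by (simp add: ac_simps)
  have "(\<integral>x. (v \<bullet> s x \<theta>)\<^sup>2 \<partial>law M p \<theta>) = (\<Sum>i\<in>UNIV. \<Sum>j\<in>UNIV. v $ i * v $ j * ?I $ i $ j)"
    unfolding sq using ij by (simp add: sample_information_def)
  also have "\<dots> = v \<bullet> (?I *v v)"
    by (simp add: inner_vec_def matrix_vector_mult_def sum_distrib_left ac_simps)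
  also have "\<dots> \<le> norm v * norm (?I *v v)" by (rule norm_cauchy_schwarz)
  also have "\<dots> \<le> norm v * (spectral_norm ?I * norm v)"
    unfolding spectral_norm_def
    by (intro mult_left_mono onorm matrix_vector_mul_bounded_linear) simp
  finally show ?thesis by (simp add: power2_eq_square ac_simps)
qed

end

lemma spectral_norm_nonneg: "0 \<le> spectral_norm B"
  unfolding spectral_norm_def by (rule onorm_pos_le[OF matrix_vector_mul_bounded_linear])

lemma spectral_norm_zero: "spectral_norm 0 = 0"
  by (simp add: spectral_norm_def onorm_zero)


section \<open>The bound for private mechanisms\<close>

lemma renyi_two_negative:
  assumes "prob_space P" "prob_space Q" "sets P = sets Q" "\<rho> < 0"
  shows "\<not> renyi_divergence 2 P Q \<le> ereal (2 * \<rho>)"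
proof
  assume "renyi_divergence 2 P Q \<le> ereal (2 * \<rho>)"
  from renyi_two_bound[OF assms(1-3) this] obtain r
    where r: "(\<integral>x. (r x - 1)\<^sup>2 \<partial>Q) \<le> exp (2 * \<rho>) - 1" by metis
  moreover have "0 \<le> (\<integral>x. (r x - 1)\<^sup>2 \<partial>Q)" by simp
  ultimately have "1 \<le> exp (2 * \<rho>)" by linarith
  with assms(4) show False by simp
qed

lemma joint_law_eq_kernel_joint:
  "joint_law M p n A N \<theta> = kernel_joint (datasets n (law M p \<theta>)) A N"
proof -
  have "sets (datasets n M \<Otimes>\<^sub>M N) = sets (datasets n (law M p \<theta>) \<Otimes>\<^sub>M N)"
    unfolding datasets_def by (intro sets_pair_measure_cong sets_PiM_cong) (auto simp: law_def)
  from return_sets_cong[OF this] show ?thesis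
    by (simp add: joint_law_def kernel_joint_def datasets_def)
qed

theorem lemmaD3:
  fixes M :: "'x measure" and N :: "'t measure"
    and \<Theta> :: "(real^'p) set"
    and p :: "real^'p \<Rightarrow> 'x \<Rightarrow> real"
    and s :: "'x \<Rightarrow> real^'p \<Rightarrow> real^'p"
    and \<pi> :: "real^'p \<Rightarrow> real"
    and A :: "(nat \<Rightarrow> 'x) \<Rightarrow> 't measure"
    and n :: nat and \<rho> :: real and \<theta> :: "real^'p"
  assumes "regular_model M \<Theta> p s \<pi>"
    and "standard_borel N"
    and "A \<in> datasets n M \<rightarrow>\<^sub>M prob_algebra N"
    and "zCDP \<rho> n M A"
    and "\<theta> \<in> interior \<Theta>"
  shows "trace (output_information M p s n A N \<theta>)
           \<le> (exp (2 * \<rho>) - 1) * (real n)\<^sup>2 * spectral_norm (sample_information M p s \<theta>)"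
proof -
  interpret regular_model M \<Theta> p s \<pi> by fact
  have \<theta>': "\<theta> \<in> \<Theta>" using assms(5) interior_subset by blast
  let ?P = "law M p \<theta>" and ?I = "sample_information M p s \<theta>"
  interpret P: prob_space ?P by (rule law_prob_space[OF \<theta>'])
  have setsP: "sets ?P = sets M" and spaceP: "space ?P = space M" by (simp_all add: law_def)
  have setsD: "sets (datasets n ?P) = sets (datasets n M)"
    unfolding datasets_def using setsP by (intro sets_PiM_cong) auto
  note spaceD = sets_eq_imp_space_eq[OF setsD]
  have channel: "A \<in> datasets n ?P \<rightarrow>\<^sub>M prob_algebra N"
    using assms(3) by (simp add: measurable_cong_sets[OF setsD refl])
  have renyi: "renyi_divergence 2 (A S) (A S') \<le> ereal (2 * \<rho>)"
    if "S \<in> space (datasets n ?P)" "S' \<in> space (datasets n ?P)" "adjacent n S S'" for S S'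
  proof -
    have "\<forall>\<alpha>>1. renyi_divergence \<alpha> (A S) (A S') \<le> ereal (\<rho> * \<alpha>)"
      using assms(4) that unfolding zCDP_def spaceD by blast
    from this[rule_format, of 2] show ?thesis by (simp add: mult.commute)
  qed
  have sm: "(\<lambda>x. s x \<theta>) \<in> borel_measurable ?P"
    using measurable_score[OF \<theta>'] by (simp add: law_def)
  have mean: "(\<integral>x. s x \<theta> \<partial>?P) = 0"
    using score_mean_zero[OF assms(5)] by (rule has_bochner_integral_integral_eq)
  \<comment> \<open>A mechanism private at level \<open>\<rho>\<close> is private at every larger level; only nonnegative levels are
    covered by the channel estimate, and \<open>\<sigma> = 0\<close> will serve negative \<open>\<rho>\<close>.\<close>
  have bound: "trace (output_information M p s n A N \<theta>) \<le> (exp (2 * \<sigma>) - 1) * (real n)\<^sup>2 * spectral_norm ?I"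
    if "\<rho> \<le> \<sigma>" "0 \<le> \<sigma>" for \<sigma>
  proof -
    interpret stable_channel ?P N n A \<sigma>
    proof (unfold_locales, rule channel, rule that(2))
      fix S S' assume "S \<in> space (datasets n ?P)" "S' \<in> space (datasets n ?P)" "adjacent n S S'"
      from order_trans[OF renyi[OF this]]
      show "renyi_divergence 2 (A S) (A S') \<le> ereal (2 * \<sigma>)" using that by simp
    qed
    have "output_score M p s n A N \<theta> = conditional_score (\<lambda>x. s x \<theta>)"
      by (simp add: fun_eq_iff output_score_def conditional_score_def joint_law_eq_kernel_joint)
    then have "trace (output_information M p s n A N \<theta>) =
       (\<Sum>i\<in>UNIV. \<integral>\<omega>. conditional_score (\<lambda>x. s x \<theta>) \<omega> $ i * conditional_score (\<lambda>x. s x \<theta>) \<omega> $ i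
          \<partial>kernel_joint (datasets n ?P) A N)"
      by (simp add: trace_def output_information_def joint_law_eq_kernel_joint)
    also have "\<dots> \<le> (exp (2 * \<sigma>) - 1) * (real n)\<^sup>2 * spectral_norm ?I"
      by (rule conditional_score_information[OF sm integrable_score_square[OF assms(5)] mean
            score_quadratic_form_le[OF assms(5)] spectral_norm_nonneg])
    finally show ?thesis .
  qed
  show ?thesis
  proof (cases "0 \<le> \<rho>")
    case True
    then show ?thesis by (intro bound) simp_all
  next
    case False
    \<comment> \<open>The factor \<open>exp (2 \<rho>) - 1\<close> is negative here, so the information must vanish. Two distinct
      points of the sample space would give adjacent datasets, whose divergence cannot be negative;
      and on a single point a score with mean zero is zero.\<close>
    have "(real n)\<^sup>2 * spectral_norm ?I = 0"
    proof (cases "n = 0")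
      case True
      then show ?thesis by simp
    next
      case n: False
      have const: "x = y" if x: "x \<in> space M" and y: "y \<in> space M" for x y
      proof (rule ccontr)
        assume xy: "x \<noteq> y"
        define S where "S = (\<lambda>i\<in>{..<n}. x)"
        have S: "S \<in> space (datasets n ?P)" "S(0 := y) \<in> space (datasets n ?P)"
          using x y n by (auto simp: space_datasets spaceP S_def PiE_iff extensional_def)
        have "adjacent n (S(0 := y)) S"
          unfolding adjacent_def using n xy by (intro exI[of _ 0]) (auto simp: S_def)
        from renyi[OF S(2,1) this] show False
          using renyi_two_negative[OF kernel_space(1)[OF channel S(2)] kernel_space(1)[OF channel S(1)], of \<rho>]
            kernel_space(2)[OF channel S(1)] kernel_space(2)[OF channel S(2)] False by simp
      qed
      obtain x0 where x0: "x0 \<in> space M" using P.not_empty spaceP by auto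
      have "(\<integral>x. s x \<theta> \<partial>?P) = (\<integral>x. s x0 \<theta> \<partial>?P)"
        by (intro Bochner_Integration.integral_cong) (auto simp: spaceP dest: const[OF x0])
      then have "s x0 \<theta> = 0" using mean by (simp add: P.prob_space)
      then have z: "s x \<theta> = 0" if "x \<in> space ?P" for x using const[OF x0] that spaceP by auto
      have "?I = 0"
        unfolding sample_information_def
        by (simp add: vec_eq_iff z cong: Bochner_Integration.integral_cong)
      then show ?thesis by (simp add: spectral_norm_zero)
    qed
    then show ?thesis using bound[of 0] False by auto
  qed
qed

end
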